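(* Suppose Assumption I holds, let $\rho>0$, $c>0$, and let $\{(w^\nu,x^\nu,\eta^\nu,\zeta^\nu)\}$ in $W\times X\times S$ be the infinite sequence generated by the inexact augmented decomposition algorithm with the stopping criterion $$\mathrm{dist}\big(0,\partial\phi_{k,\rho,c}^\nu(x_k^{\nu+1})\big)\le\frac{\epsilon_\nu}{cK(\rho\|E\|+\|E\|+1)},\qquad\sum_{\nu=0}^\infty\epsilon_\nu<\infty .$$ Then $(w^\nu,x^\nu,\eta^\nu,\zeta^\nu)$ converges to some saddle point $(\bar w,\bar x,\bar\eta,\bar\zeta)$ of $\bar L$ such that (a) $(\bar w,\bar x)$ solves problem (P$_w$), hence $\bar x$ solves problem (P); (b) $\bar\eta_1=\cdots=\bar\eta_K\in\mathbb{R}^m$, and this common multiplier vector solves the dual problem (D).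
   Context: Problem (P): minimize $f(x)=f_1(x_1)+\cdots+f_K(x_K)$ subject to $Ex=E_1x_1+\cdots+E_Kx_K=q$, $x_k\in X_k$ ($k=1,\dots,K$), where $x=(x_1,\dots,x_K)\in\mathbb{R}^{n_1}\times\cdots\times\mathbb{R}^{n_K}=\mathbb{R}^n$, each $f_k$ is a closed proper convex function (possibly nonsmooth), each $X_k\subset\mathbb{R}^{n_k}$ is a closed convex set, $X=X_1\times\cdots\times X_K$, $E=(E_1,\dots,E_K)\in\mathbb{R}^{m\times n}$, $q\in\mathbb{R}^m$. $\|E\|$ is the spectral norm. Assumption I. The global minimum of (P) is attainable, and $\mathrm{int}(X)\cap\mathrm{dom} f\cap\{x: Ex=q\}\neq\emptyset$; if $X$ is polyhedral, an alternative to the latter condition is $X\cap\mathrm{int}(\mathrm{dom} f)\cap\{x:Ex=q\}\ne\emptyset$. Problem (D): maximize $d(y)=\min_{x\in X}\{f(x)+\langle y,Ex-q\rangle\}$ over $y\in\mathbb{R}^m$. Problem (P$_w$): minimize $f(x)$ over $(x,w)$ subject to $E_jx_j-w_j=0$ ($j=1,\dots,K-1$), $E_Kx_K-q-w_K=0$, $w_1+\cdots+w_K=0$, $x_k\in X_k$ ($k=1,\dots,K$). Spaces. $W=\{w=(w_1,\dots,w_K)\in(\mathbb{R}^m)^K: w_1+\cdots+w_K=0\}$, $W^\perp=\{w\in(\mathbb{R}^m)^K: w_1=\cdots=w_K\}$, $P_{W^\perp}$ is the orthogonal projection onto $W^\perp$, and $S=\{(\eta,\zeta)\in(\mathbb{R}^m)^K\times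 W^\perp: P_{W^\perp}(\eta)=\zeta\}$. Put $q_k=0$ for $k<K$ and $q_K=q$. Lagrangian. $\bar L(w,x,\eta,\zeta)=\sum_{j=1}^K[f_j(x_j)+\langle\eta_j,E_jx_j-q_j\rangle-\langle\eta_j,w_j\rangle]$ if $(w,x)\in W\times X$ and $(\eta,\zeta)\in S$; $\bar L=-\infty$ if $(w,x)\in W\times X$ and $(\eta,\zeta)\notin S$; $\bar L=+\infty$ if $(w,x)\notin W\times X$. A saddle point of $\bar L$ is a point of $W\times X\times S$ at which $\bar L$ is minimal with respect to $(w,x)\in W\times X$ and maximal with respect to $(\eta,\zeta)\in S$. Inexact augmented decomposition algorithm. Given $w^0\in W$, $x^0\in X$, $y^0\in(\mathbb{R}^m)^K$. For $\nu=0,1,2,\dots$ let $$\phi_{k,\rho,c}^\nu(x_k)=f_k(x_k)+\tfrac{\rho}{4}\|E_kx_k-q_k-w_k^\nu+\tfrac2\rho y_k^\nu\|_2^2+\tfrac1{2c}\|x_k-x_k^\nu\|_2^2,$$ and for $k=1,\dots,K$: $x_k^{\nu+1}\approx\arg\min_{x_k\in X_k}\phi^\nu_{k,\rho,c}(x_k)$ (the accuracy being governed by the stopping criterion in the claim, required for every $k$ and $\nu$); $\eta_k^{\nu+1}=y_k^\nu+\frac{\rho}{2}[E_kx_k^{\nu+1}-q_k-w_k^\nu]$; $\zeta_k^{\nu+1}=\frac1K\sum_{j=1}^K\eta_j^{\nu+1}$; $w_k^{\nu+1}=w_k^\nu+\frac1\rho[\eta_k^{\nu+1}-\zeta_k^{\nu+1}]$;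 $y_k^{\nu+1}=\frac12[\eta_k^{\nu+1}+\zeta_k^{\nu+1}]$. Here $\partial$ denotes the subdifferential and dist the Euclidean distance.
   Formalization: Added hypothesis: the relative interior of dom f meets {x: Ex=q}; automatic for finite f or under the second alternative of Assumption I. Without it the claim fails: K=n=m=1, X=R, E=1, q=0, f(x)=-sqrt(x) on x>=0, +infinity for x<0, where (D) has no solution. *)

theory Defs
  imports "HOL-Analysis.Analysis"
begin

text \<open>
  The product \<open>R^{n_1} \<times> \<dots> \<times> R^{n_K}\<close> is \<open>real^'n\<close> together with a map \<open>blk :: 'n \<Rightarrow> 'k\<close> assigning to
  each of the \<open>n\<close> coordinates its block; \<open>K = CARD('k)\<close> and \<open>n_k\<close> is the number of coordinates in
  block \<open>k\<close>. The factor \<open>R^{n_k}\<close> is the coordinate subspace \<open>block_space blk k\<close>, and the component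
  \<open>x_k\<close> of \<open>x\<close> is \<open>part blk k x\<close>. For \<open>u\<close> in \<open>block_space blk k\<close>, \<open>E *v u\<close> is the product of the
  column block \<open>E_k\<close> with \<open>u\<close>. Functions \<open>f k\<close> are only ever evaluated on \<open>block_space blk k\<close>.
  The block that carries \<open>q\<close> (the one numbered \<open>K\<close>) is an index \<open>l :: 'k\<close>.
\<close>

definition part :: "('n \<Rightarrow> 'k) \<Rightarrow> 'k \<Rightarrow> real^'n \<Rightarrow> real^'n" where
  "part blk k x = (\<chi> i. if blk i = k then x $ i else 0)"

definition block_space :: "('n \<Rightarrow> 'k) \<Rightarrow> 'k \<Rightarrow> (real^'n) set" where
  "block_space blk k = {x. \<forall>i. blk i \<noteq> k \<longrightarrow> x $ i = 0}"

section \<open>Extended-real-valued convex functions on a subspace\<close>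

definition epi_on :: "'a set \<Rightarrow> ('a \<Rightarrow> ereal) \<Rightarrow> ('a \<times> real) set" where
  "epi_on V g = {(u, r). u \<in> V \<and> g u \<le> ereal r}"

definition closed_proper_convex_on :: "'a::euclidean_space set \<Rightarrow> ('a \<Rightarrow> ereal) \<Rightarrow> bool" where
  "closed_proper_convex_on V g \<longleftrightarrow>
     closed (epi_on V g) \<and> convex (epi_on V g) \<and>
     (\<forall>u\<in>V. g u \<noteq> -\<infinity>) \<and> (\<exists>u\<in>V. g u \<noteq> \<infinity>)"

definition effective_dom :: "('a \<Rightarrow> ereal) \<Rightarrow> 'a set" where
  "effective_dom g = {u. g u < \<infinity>}"

definition subdifferential_on ::
    "'a::euclidean_space set \<Rightarrow> ('a \<Rightarrow> ereal) \<Rightarrow> 'a \<Rightarrow> 'a set" where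
  "subdifferential_on V g u = {s \<in> V. \<forall>z\<in>V. g u + ereal (s \<bullet> (z - u)) \<le> g z}"

text \<open>Distance from the origin; unlike \<^const>\<open>infdist\<close> it is \<open>\<infinity>\<close> for the empty set.\<close>

definition dist_zero :: "'a::euclidean_space set \<Rightarrow> ereal" where
  "dist_zero S = (INF s\<in>S. ereal (norm s))"

definition restrict_to :: "'a set \<Rightarrow> ('a \<Rightarrow> ereal) \<Rightarrow> 'a \<Rightarrow> ereal" where
  "restrict_to C g u = (if u \<in> C then g u else \<infinity>)"

section \<open>The primal and dual problems\<close>

definition block_product :: "('n \<Rightarrow> 'k) \<Rightarrow> ('k \<Rightarrow> (real^'n) set) \<Rightarrow> (real^'n) set" where
  "block_product blk X = {x. \<forall>k. part blk k x \<in> X k}"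

definition objective :: "('n \<Rightarrow> 'k::finite) \<Rightarrow> ('k \<Rightarrow> real^'n \<Rightarrow> ereal) \<Rightarrow> real^'n \<Rightarrow> ereal" where
  "objective blk f x = (\<Sum>k\<in>UNIV. f k (part blk k x))"

definition solves_P ::
    "('n \<Rightarrow> 'k::finite) \<Rightarrow> ('k \<Rightarrow> real^'n \<Rightarrow> ereal) \<Rightarrow> ('k \<Rightarrow> (real^'n) set) \<Rightarrow>
     real^'n^'m \<Rightarrow> real^'m \<Rightarrow> real^'n \<Rightarrow> bool" where
  "solves_P blk f X E q x \<longleftrightarrow>
     is_arg_min (objective blk f) (\<lambda>x. x \<in> block_product blk X \<and> E *v x = q) x"

definition assumption_I ::
    "('n::finite \<Rightarrow> 'k::finite) \<Rightarrow> ('k \<Rightarrow> real^'n \<Rightarrow> ereal) \<Rightarrow> ('k \<Rightarrow> (real^'n) set) \<Rightarrow>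
     real^'n^'m \<Rightarrow> real^'m \<Rightarrow> bool" where
  "assumption_I blk f X E q \<longleftrightarrow>
     (\<exists>x. solves_P blk f X E q x) \<and>
     (interior (block_product blk X) \<inter> effective_dom (objective blk f) \<inter> {x. E *v x = q} \<noteq> {} \<or>
      polyhedron (block_product blk X) \<and>
      block_product blk X \<inter> interior (effective_dom (objective blk f)) \<inter> {x. E *v x = q} \<noteq> {})"

text \<open>
  The first alternative of \<^const>\<open>assumption_I\<close> alone does not give a Lagrange multiplier: for
  \<open>K = n = m = 1\<close>, \<open>X = R\<close>, \<open>E = 1\<close>, \<open>q = 0\<close> and \<open>f x = - sqrt x\<close> for \<open>x \<ge> 0\<close>, \<open>f x = \<infinity>\<close> for
  \<open>x < 0\<close>, it holds at \<open>x = 0\<close>, but \<open>d y = - 1 / (4 y)\<close> for \<open>y > 0\<close> and \<open>d y = -\<infinity>\<close> for \<open>y \<le> 0\<close>,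
  so the dual supremum \<open>0\<close> is not attained. The condition below excludes this. It is automatic
  for finite-valued \<open>f\<close> (when the problem is feasible) and under the second alternative.
\<close>

definition domain_qualification ::
    "('n::finite \<Rightarrow> 'k::finite) \<Rightarrow> ('k \<Rightarrow> real^'n \<Rightarrow> ereal) \<Rightarrow> real^'n^'m \<Rightarrow> real^'m \<Rightarrow> bool" where
  "domain_qualification blk f E q \<longleftrightarrow>
     rel_interior (effective_dom (objective blk f)) \<inter> {x. E *v x = q} \<noteq> {}"

definition dual_objective ::
    "('n \<Rightarrow> 'k::finite) \<Rightarrow> ('k \<Rightarrow> real^'n \<Rightarrow> ereal) \<Rightarrow> ('k \<Rightarrow> (real^'n) set) \<Rightarrow>
     real^'n^'m \<Rightarrow> real^'m \<Rightarrow> real^'m \<Rightarrow> ereal" where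
  "dual_objective blk f X E q y =
     (INF x\<in>block_product blk X. objective blk f x + ereal (y \<bullet> (E *v x - q)))"

definition solves_D ::
    "('n \<Rightarrow> 'k::finite) \<Rightarrow> ('k \<Rightarrow> real^'n \<Rightarrow> ereal) \<Rightarrow> ('k \<Rightarrow> (real^'n) set) \<Rightarrow>
     real^'n^'m \<Rightarrow> real^'m \<Rightarrow> real^'m \<Rightarrow> bool" where
  "solves_D blk f X E q y \<longleftrightarrow> is_arg_max (dual_objective blk f X E q) (\<lambda>_. True) y"

definition feasible_Pw ::
    "('n \<Rightarrow> 'k::finite) \<Rightarrow> 'k \<Rightarrow> ('k \<Rightarrow> (real^'n) set) \<Rightarrow> real^'n^'m \<Rightarrow> real^'m \<Rightarrow>
     ((real^'m^'k) \<times> (real^'n)) set" where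
  "feasible_Pw blk l X E q =
     {(w, x). (\<forall>j. j \<noteq> l \<longrightarrow> E *v part blk j x - w $ j = 0) \<and>
              E *v part blk l x - q - w $ l = 0 \<and>
              (\<Sum>k\<in>UNIV. w $ k) = 0 \<and>
              (\<forall>k. part blk k x \<in> X k)}"

definition solves_Pw ::
    "('n \<Rightarrow> 'k::finite) \<Rightarrow> 'k \<Rightarrow> ('k \<Rightarrow> real^'n \<Rightarrow> ereal) \<Rightarrow> ('k \<Rightarrow> (real^'n) set) \<Rightarrow>
     real^'n^'m \<Rightarrow> real^'m \<Rightarrow> (real^'m^'k) \<times> (real^'n) \<Rightarrow> bool" where
  "solves_Pw blk l f X E q p \<longleftrightarrow>
     is_arg_min (\<lambda>(w, x). objective blk f x) (\<lambda>p. p \<in> feasible_Pw blk l X E q) p"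

section \<open>The Lagrangian and its saddle points\<close>

definition W_space :: "(real^'m^'k::finite) set" where
  "W_space = {w. (\<Sum>k\<in>UNIV. w $ k) = 0}"

definition W_perp :: "(real^'m^'k::finite) set" where
  "W_perp = {w. \<forall>j k. w $ j = w $ k}"

text \<open>\<open>closest_point W_perp\<close> is the orthogonal projection onto the subspace \<^term>\<open>W_perp\<close>.\<close>

definition S_space :: "((real^'m^'k::finite) \<times> (real^'m^'k)) set" where
  "S_space = {(\<eta>, \<zeta>). \<zeta> \<in> W_perp \<and> closest_point W_perp \<eta> = \<zeta>}"

definition q_block :: "'k \<Rightarrow> real^'m \<Rightarrow> 'k \<Rightarrow> real^'m" where
  "q_block l q k = (if k = l then q else 0)"

definition lagrangian ::
    "('n \<Rightarrow> 'k::finite) \<Rightarrow> 'k \<Rightarrow> ('k \<Rightarrow> real^'n \<Rightarrow> ereal) \<Rightarrow> ('k \<Rightarrow> (real^'n) set) \<Rightarrow>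
     real^'n^'m \<Rightarrow> real^'m \<Rightarrow>
     (real^'m^'k) \<times> (real^'n) \<Rightarrow> (real^'m^'k) \<times> (real^'m^'k) \<Rightarrow> ereal" where
  "lagrangian blk l f X E q = (\<lambda>(w, x) (\<eta>, \<zeta>).
     if (w, x) \<notin> W_space \<times> block_product blk X then \<infinity>
     else if (\<eta>, \<zeta>) \<notin> S_space then -\<infinity>
     else (\<Sum>j\<in>UNIV. f j (part blk j x)
             + ereal (\<eta> $ j \<bullet> (E *v part blk j x - q_block l q j))
             - ereal (\<eta> $ j \<bullet> w $ j)))"

definition saddle_point ::
    "('n \<Rightarrow> 'k::finite) \<Rightarrow> 'k \<Rightarrow> ('k \<Rightarrow> real^'n \<Rightarrow> ereal) \<Rightarrow> ('k \<Rightarrow> (real^'n) set) \<Rightarrow>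
     real^'n^'m \<Rightarrow> real^'m \<Rightarrow>
     (real^'m^'k) \<times> (real^'n) \<Rightarrow> (real^'m^'k) \<times> (real^'m^'k) \<Rightarrow> bool" where
  "saddle_point blk l f X E q p d \<longleftrightarrow>
     is_arg_min (\<lambda>p'. lagrangian blk l f X E q p' d)
                (\<lambda>p'. p' \<in> W_space \<times> block_product blk X) p \<and>
     is_arg_max (\<lambda>d'. lagrangian blk l f X E q p d') (\<lambda>d'. d' \<in> S_space) d"

section \<open>The inexact augmented decomposition algorithm\<close>

definition phi ::
    "('n \<Rightarrow> 'k::finite) \<Rightarrow> 'k \<Rightarrow> ('k \<Rightarrow> real^'n \<Rightarrow> ereal) \<Rightarrow> real^'n^'m \<Rightarrow> real^'m \<Rightarrow>
     real \<Rightarrow> real \<Rightarrow> real^'m^'k \<Rightarrow> real^'n \<Rightarrow> real^'m^'k \<Rightarrow> 'k \<Rightarrow> real^'n \<Rightarrow> ereal" where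
  "phi blk l f E q \<rho> c w x y k u =
     f k u + ereal (\<rho> / 4 * (norm (E *v u - q_block l q k - w $ k + (2 / \<rho>) *\<^sub>R y $ k))\<^sup>2
                    + 1 / (2 * c) * (norm (u - part blk k x))\<^sup>2)"

text \<open>Iterates with index \<open>0\<close> of \<open>\<eta>\<close> and \<open>\<zeta>\<close> are not produced by the algorithm and are arbitrary.\<close>

definition algorithm_run ::
    "('n \<Rightarrow> 'k::finite) \<Rightarrow> 'k \<Rightarrow> ('k \<Rightarrow> (real^'n) set) \<Rightarrow> real^'n^'m \<Rightarrow> real^'m \<Rightarrow> real \<Rightarrow>
     (nat \<Rightarrow> real^'m^'k) \<Rightarrow> (nat \<Rightarrow> real^'n) \<Rightarrow> (nat \<Rightarrow> real^'m^'k) \<Rightarrow>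
     (nat \<Rightarrow> real^'m^'k) \<Rightarrow> (nat \<Rightarrow> real^'m^'k) \<Rightarrow> bool" where
  "algorithm_run blk l X E q \<rho> w x y \<eta> \<zeta> \<longleftrightarrow>
     w 0 \<in> W_space \<and> x 0 \<in> block_product blk X \<and>
     (\<forall>\<nu> k.
        part blk k (x (Suc \<nu>)) \<in> X k \<and>
        \<eta> (Suc \<nu>) $ k = y \<nu> $ k + (\<rho> / 2) *\<^sub>R (E *v part blk k (x (Suc \<nu>)) - q_block l q k - w \<nu> $ k) \<and>
        \<zeta> (Suc \<nu>) $ k = (1 / real CARD('k)) *\<^sub>R (\<Sum>j\<in>UNIV. \<eta> (Suc \<nu>) $ j) \<and>
        w (Suc \<nu>) $ k = w \<nu> $ k + (1 / \<rho>) *\<^sub>R (\<eta> (Suc \<nu>) $ k - \<zeta> (Suc \<nu>) $ k) \<and>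
        y (Suc \<nu>) $ k = (1 / 2) *\<^sub>R (\<eta> (Suc \<nu>) $ k + \<zeta> (Suc \<nu>) $ k))"

text \<open>
  The \<open>k\<close>-th subproblem minimizes \<^const>\<open>phi\<close> over \<open>X k\<close>, so the subdifferential in the stopping
  criterion is that of \<^const>\<open>phi\<close> with value \<open>\<infinity>\<close> off \<open>X k\<close>. The criterion with the
  subdifferential of the unrestricted function is stronger, see \<open>dist_zero_restrict_to_le\<close>.
\<close>

definition stopping_criterion ::
    "('n::finite \<Rightarrow> 'k::finite) \<Rightarrow> 'k \<Rightarrow> ('k \<Rightarrow> real^'n \<Rightarrow> ereal) \<Rightarrow> ('k \<Rightarrow> (real^'n) set) \<Rightarrow>
     real^'n^'m \<Rightarrow> real^'m \<Rightarrow> real \<Rightarrow> real \<Rightarrow> (nat \<Rightarrow> real) \<Rightarrow>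
     (nat \<Rightarrow> real^'m^'k) \<Rightarrow> (nat \<Rightarrow> real^'n) \<Rightarrow> (nat \<Rightarrow> real^'m^'k) \<Rightarrow> bool" where
  "stopping_criterion blk l f X E q \<rho> c \<epsilon> w x y \<longleftrightarrow>
     (\<forall>\<nu> k.
        dist_zero (subdifferential_on (block_space blk k)
            (restrict_to (X k) (phi blk l f E q \<rho> c (w \<nu>) (x \<nu>) (y \<nu>) k))
            (part blk k (x (Suc \<nu>))))
        \<le> ereal (\<epsilon> \<nu> / (c * real CARD('k) * (\<rho> * onorm ((*v) E) + onorm ((*v) E) + 1))))"

lemma dist_zero_restrict_to_le:
  assumes "u \<in> C"
  shows "dist_zero (subdifferential_on V (restrict_to C g) u) \<le> dist_zero (subdifferential_on V g u)"
  unfolding dist_zero_def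
  using assms by (intro INF_superset_mono) (auto simp: subdifferential_on_def restrict_to_def)

lemma domain_qualification_if_interior:
  assumes "interior (effective_dom (objective blk f)) \<inter> {x. E *v x = q} \<noteq> {}"
  shows "domain_qualification blk f E q"
  using assms interior_subset_rel_interior unfolding domain_qualification_def by blast

end

theory Submission
  imports Defs
begin

text \<open>
  Write \<open>z\<^sup>\<nu>\<close> for the mean of \<open>y\<^sup>\<nu>\<close> and \<open>d\<^sup>\<nu>\<close> for \<open>2/\<rho>\<close> times its component in \<open>W\<close>. The subgradient inequality at the
  inexact minimizer, tested against a Karush-Kuhn-Tucker point \<open>(w*, x*, y*)\<close>, shows that
  \<open>|z\<^sup>\<nu> - y*|\<^sup>2/\<rho> + \<rho>/2 |w\<^sup>\<nu> - w*|\<^sup>2 + \<rho>/2 |d\<^sup>\<nu>|\<^sup>2 + |x\<^sup>\<nu> - x*|\<^sup>2/(2c)\<close> decreases by the squared increments of the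
  iterates, up to a summable error relative to its square root. Hence it converges, the increments
  vanish, every cluster point is a Karush-Kuhn-Tucker point, and the same estimate with that cluster
  point in place of \<open>(w*, x*, y*)\<close> gives convergence of the whole sequence. A Karush-Kuhn-Tucker point
  exists by separation of convex sets; when \<open>X\<close> is polyhedral the separation is first carried out for
  the constraint set \<open>{x \<in> X. E x = q}\<close>, and Farkas' lemma then isolates the multiplier of \<open>E x = q\<close>.
\<close>

section \<open>Lagrange multipliers\<close>

text \<open>Separates \<open>(0, G x)\<close> from the convex set \<open>T\<close> of pairs of a
  residual and an upper bound for the value. The relative interior point \<open>x0\<close> keeps the
  separating hyperplane from being vertical, so that its last coefficient can be normalised to
  1.\<close>

lemma lagrange_multiplier_rel_interior:
  fixes L :: "'a::euclidean_space \<Rightarrow> 'b::euclidean_space" and G :: "'a \<Rightarrow> real"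
  assumes L: "linear L" and C: "convex C" and G: "convex_on C G"
    and x: "x \<in> C" "L x = q" and min: "\<And>z. z \<in> C \<Longrightarrow> L z = q \<Longrightarrow> G x \<le> G z"
    and x0: "x0 \<in> rel_interior C" "L x0 = q"
  shows "\<exists>y. \<forall>z\<in>C. G x \<le> G z + y \<bullet> (L z - q)"
proof -
  define T where "T = {(L z - q, r) | z r. z \<in> C \<and> G z \<le> r}"
  have T: "convex T"
  proof (rule convexI)
    fix p p' and u v :: real
    assume p: "p \<in> T" "p' \<in> T" and uv: "0 \<le> u" "0 \<le> v" "u + v = 1"
    obtain z r z' r' where z: "p = (L z - q, r)" "z \<in> C" "G z \<le> r"
        "p' = (L z' - q, r')" "z' \<in> C" "G z' \<le> r'"
      using p unfolding T_def by blast
    have "G (u *\<^sub>R z + v *\<^sub>R z') \<le> u * G z + v * G z'"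
      using G uv z by (simp add: convex_on_def)
    also have "\<dots> \<le> u * r + v * r'"
      using z uv by (intro add_mono mult_left_mono) auto
    finally have "G (u *\<^sub>R z + v *\<^sub>R z') \<le> u * r + v * r'" .
    moreover have "u *\<^sub>R z + v *\<^sub>R z' \<in> C"
      using C uv z by (simp add: convexD)
    moreover have "u *\<^sub>R (L z - q) + v *\<^sub>R (L z' - q) = L (u *\<^sub>R z + v *\<^sub>R z') - (u + v) *\<^sub>R q"
      by (simp add: linear_add[OF L] linear_cmul[OF L] algebra_simps)
    then have "u *\<^sub>R (L z - q) + v *\<^sub>R (L z' - q) = L (u *\<^sub>R z + v *\<^sub>R z') - q"
      using uv by simp
    ultimately show "u *\<^sub>R p + v *\<^sub>R p' \<in> T"
      unfolding T_def z by force
  qed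
  have xT: "(0, G x + t) \<in> T" if "t \<ge> 0" for t
    using x that unfolding T_def by force
  \<comment> \<open>Otherwise the segment from \<open>(0, G x + 1)\<close> could be prolonged beyond
    \<open>(0, G x)\<close> inside \<open>T\<close>, giving a feasible point of value below
    \<open>G x\<close>.\<close>
  have "(0, G x) \<notin> rel_interior T"
  proof
    assume "(0, G x) \<in> rel_interior T"
    then obtain e where e: "e > 1" "(1 - e) *\<^sub>R (0, G x + 1) + e *\<^sub>R (0, G x) \<in> T"
      using convex_rel_interior_iff[OF T] xT[of 1] by fastforce
    then obtain z where "z \<in> C" "L z = q" "G z \<le> (1 - e) * (G x + 1) + e * G x"
      unfolding T_def by auto
    then show False
      using min[of z] e by (simp add: algebra_simps)
  qed
  then obtain a where a: "\<And>p. p \<in> T \<Longrightarrow> a \<bullet> (0, G x) \<le> a \<bullet> p"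
      "\<And>p. p \<in> rel_interior T \<Longrightarrow> a \<bullet> (0, G x) < a \<bullet> p"
    using supporting_hyperplane_rel_boundary[OF T] xT[of 0] by (metis add.right_neutral order_refl)
  obtain y \<beta> where ay: "a = (y, \<beta>)" by fastforce
  have sup: "\<beta> * G x \<le> y \<bullet> (L z - q) + \<beta> * r" if "z \<in> C" "G z \<le> r" for z r
    using a(1)[of "(L z - q, r)"] that unfolding T_def ay by auto
  have "\<beta> \<ge> 0"
    using sup[of x "G x + 1"] x by (simp add: algebra_simps)
  \<comment> \<open>If \<beta> = 0, the functional \<open>y\<close> is nonnegative on all residuals.
    Prolonging the segment from \<open>z\<close> through \<open>x0\<close> reverses the sign of the
    residual, so the functional vanishes on all of \<open>T\<close>, against the strict inequality
    on the relative interior.\<close>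
  moreover have "\<beta> \<noteq> 0"
  proof
    assume b: "\<beta> = 0"
    have nonneg: "0 \<le> y \<bullet> (L z - q)" if "z \<in> C" for z
      using sup[of z "G z"] that b by simp
    have zero: "y \<bullet> (L z - q) = 0" if z: "z \<in> C" for z
    proof -
      obtain e where e: "e > 1" "(1 - e) *\<^sub>R z + e *\<^sub>R x0 \<in> C"
        using convex_rel_interior_iff[OF C] x0 z by blast
      have "L ((1 - e) *\<^sub>R z + e *\<^sub>R x0) - q = (1 - e) *\<^sub>R (L z - q)"
        using x0 by (simp add: linear_add[OF L] linear_diff[OF L] linear_cmul[OF L] scaleR_diff_left scaleR_diff_right)
      then have "0 \<le> (1 - e) * (y \<bullet> (L z - q))"
        using nonneg[OF e(2)] by simp
      then show ?thesis
        using nonneg[OF z] e(1) by (simp add: zero_le_mult_iff)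
    qed
    obtain p where p: "p \<in> rel_interior T"
      using T xT[of 0] rel_interior_eq_empty by fastforce
    then have "p \<in> T"
      using rel_interior_subset by blast
    then have "a \<bullet> p = 0"
      using zero b unfolding T_def ay by auto
    then show False
      using a(2)[OF p] b ay by simp
  qed
  ultimately have b: "\<beta> > 0" by simp
  show ?thesis
  proof (intro exI ballI)
    fix z assume "z \<in> C"
    then have "\<beta> * G x \<le> \<beta> * (G z + ((1/\<beta>) *\<^sub>R y) \<bullet> (L z - q))"
      using sup[of z "G z"] b by (simp add: algebra_simps)
    then show "G x \<le> G z + ((1/\<beta>) *\<^sub>R y) \<bullet> (L z - q)"
      using b mult_le_cancel_left_pos by blast
  qed
qed

text \<open>
  Farkas' lemma: otherwise \<open>g\<close> is separated from the closed cone generated by the normals of the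
  constraints active at \<open>x\<close> and the rows of \<open>\<plusminus>L\<close>, and the separating vector is a feasible ascent direction.
\<close>

lemma lp_multiplier:
  fixes L :: "'a::euclidean_space \<Rightarrow> 'b::euclidean_space"
  assumes L: "linear L" and X: "polyhedron X" and x: "x \<in> X" "L x = q"
    and max: "\<And>z. z \<in> X \<Longrightarrow> L z = q \<Longrightarrow> g \<bullet> z \<le> g \<bullet> x"
  shows "\<exists>y. \<forall>z\<in>X. g \<bullet> z \<le> g \<bullet> x + y \<bullet> (L z - q)"
proof -
  obtain F where F: "finite F" "X = \<Inter>F" "\<forall>h\<in>F. \<exists>a b. a \<noteq> 0 \<and> h = {x. a \<bullet> x \<le> b}"
    using X unfolding polyhedron_def by blast
  then obtain a b where ab: "\<And>h. h \<in> F \<Longrightarrow> h = {x. a h \<bullet> x \<le> b h}"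
    by metis
  have Xab: "z \<in> X \<longleftrightarrow> (\<forall>h\<in>F. a h \<bullet> z \<le> b h)" for z
    using F(2) ab by blast
  define J where "J = {h \<in> F. a h \<bullet> x = b h}"
  define S where "S = a ` J \<union> adjoint L ` Basis \<union> uminus ` adjoint L ` Basis"
  \<comment> \<open>\<open>K\<close> collects the vectors for which the claim holds; being a convex
    cone that contains \<open>S\<close>, it contains the hull and hence \<open>g\<close>.\<close>
  define K where "K = {v. \<exists>y. \<forall>z\<in>X. v \<bullet> (z - x) \<le> y \<bullet> (L z - q)}"
  have adj: "adjoint L e \<bullet> d = e \<bullet> L d" for e d
    using adjoint_works[OF L, of d e] by (simp add: inner_commute)
  have "finite S"
    unfolding S_def J_def using F(1) by simp
  then have closed: "closed (convex_cone hull S)"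
    by (rule closed_convex_cone_hull)
  have "g \<in> convex_cone hull S"
  proof (rule ccontr)
    assume "g \<notin> convex_cone hull S"
    then obtain d \<beta> where d: "d \<bullet> g < \<beta>" "\<And>v. v \<in> convex_cone hull S \<Longrightarrow> \<beta> < d \<bullet> v"
      using separating_hyperplane_closed_point[OF convex_convex_cone_hull closed] by blast
    have "\<beta> < 0"
      using d(2)[OF convex_cone_hull_contains_0] by simp
    \<comment> \<open>A functional bounded below on a cone cannot be negative there: rescaling
      \<open>v\<close> would reach the value \<beta>, which is excluded.\<close>
    have pos: "0 \<le> d \<bullet> v" if "v \<in> convex_cone hull S" for v
    proof (rule ccontr)
      assume "\<not> 0 \<le> d \<bullet> v"
      then have "\<beta> / (d \<bullet> v) * (d \<bullet> v) = \<beta>" "\<beta> / (d \<bullet> v) \<ge> 0"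
        using \<open>\<beta> < 0\<close> by (auto simp: divide_nonpos_nonpos)
      then show False
        using d(2)[OF convex_cone_hull_mul[OF that, of "\<beta> / (d \<bullet> v)"]] by simp
    qed
    have "L d \<bullet> e = 0" if "e \<in> Basis" for e
    proof -
      have "adjoint L e \<in> S" "- adjoint L e \<in> S"
        using that unfolding S_def by blast+
      then have "0 \<le> d \<bullet> adjoint L e" "0 \<le> d \<bullet> - adjoint L e"
        by (blast intro: pos hull_inc)+
      then show ?thesis
        using adj[of e d] by (simp add: inner_commute)
    qed
    then have Ld: "L d = 0"
      using euclidean_all_zero_iff by blast
    have J: "0 \<le> a h \<bullet> d" if "h \<in> J" for h
    proof -
      have "a h \<in> S"
        using that unfolding S_def by blast
      then show ?thesis
        using pos[OF hull_inc, of "a h"] by (metis inner_commute)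
    qed
    have "\<forall>\<^sub>F t in at_right 0. a h \<bullet> (x - t *\<^sub>R d) \<le> b h" if h: "h \<in> F" for h
    \<comment> \<open>Constraints active at \<open>x\<close> do not increase along
      \<open>-d\<close>; the others have slack, which persists for small \<open>t\<close>.\<close>
    proof (cases "h \<in> J")
      case True
      then have "a h \<bullet> (x - t *\<^sub>R d) \<le> b h" if "t > 0" for t
        using J[OF True] that by (simp add: J_def inner_diff_right mult_nonneg_nonneg)
      then show ?thesis
        by (rule eventually_mono[OF eventually_at_right_less])
    next
      case False
      then have "a h \<bullet> x < b h"
        using h x(1) Xab by (force simp: J_def)
      moreover have "((\<lambda>t. a h \<bullet> (x - t *\<^sub>R d)) \<longlongrightarrow> a h \<bullet> (x - 0 *\<^sub>R d)) (at_right 0)"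
        by (intro tendsto_intros)
      ultimately have "\<forall>\<^sub>F t in at_right 0. a h \<bullet> (x - t *\<^sub>R d) < b h"
        by (simp add: order_tendstoD(2))
      then show ?thesis
        by (rule eventually_mono) simp
    qed
    then have "\<forall>\<^sub>F t in at_right 0. \<forall>h\<in>F. a h \<bullet> (x - t *\<^sub>R d) \<le> b h"
      using F(1) by (simp add: eventually_ball_finite)
    then have "\<forall>\<^sub>F t in at_right 0. t > 0 \<and> x - t *\<^sub>R d \<in> X"
      using eventually_at_right_less[of "0::real"] by eventually_elim (simp add: Xab)
    then obtain t :: real where t: "t > 0" "x - t *\<^sub>R d \<in> X"
      using eventually_happens' trivial_limit_at_right_real by (metis (no_types, lifting))
    have "g \<bullet> (x - t *\<^sub>R d) \<le> g \<bullet> x"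
      using t x by (intro max) (simp_all add: linear_diff[OF L] linear_cmul[OF L] Ld)
    moreover have "g \<bullet> d < 0"
      using d(1) \<open>\<beta> < 0\<close> by (simp add: inner_commute)
    ultimately show False
      using t(1) by (simp add: inner_diff_right mult_less_0_iff not_le zero_le_mult_iff)
  qed
  moreover have "convex_cone hull S \<subseteq> K"
  proof (rule hull_minimal)
    have "a h \<bullet> (z - x) \<le> 0 \<bullet> (L z - q)" if "h \<in> J" "z \<in> X" for h z
      using that Xab[of z] by (auto simp: J_def inner_diff_right)
    moreover have "adjoint L e \<bullet> (z - x) \<le> e \<bullet> (L z - q)"
       "- adjoint L e \<bullet> (z - x) \<le> (- e) \<bullet> (L z - q)" for e z
      using adj[of e "z - x"] x by (simp_all add: linear_diff[OF L])
    ultimately show "S \<subseteq> K"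
      unfolding S_def K_def by (intro subsetI) (elim UnE imageE; blast)
    show "convex_cone K"
      unfolding convex_cone_iff K_def mem_Collect_eq
    proof (intro conjI ballI allI impI, goal_cases)
      case 1 show ?case by (auto intro!: exI[of _ 0])
    next
      case (2 u v)
      then obtain y y' where "\<forall>z\<in>X. u \<bullet> (z - x) \<le> y \<bullet> (L z - q)" "\<forall>z\<in>X. v \<bullet> (z - x) \<le> y' \<bullet> (L z - q)"
        by blast
      then show ?case
        by (intro CollectI exI[of _ "y + y'"]) (auto simp: inner_add_left intro!: add_mono)
    next
      case (3 v c)
      then obtain y where "\<forall>z\<in>X. v \<bullet> (z - x) \<le> y \<bullet> (L z - q)"
        by blast
      then show ?case
        using 3 by (intro CollectI exI[of _ "c *\<^sub>R y"]) (auto intro!: mult_left_mono)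
    qed
  qed
  ultimately show ?thesis
    unfolding K_def by (auto simp: inner_diff_right algebra_simps)
qed

text \<open>Turns two qualification points into one: a small step from \<open>x0\<close> towards
  \<open>x1\<close> stays in the open set \<open>interior X\<close>, and every point strictly
  between \<open>x0\<close> and \<open>x1\<close> is in the relative interior of
  \<open>D\<close>.\<close>

lemma segment_meets_interior_rel_interior:
  fixes x0 :: "'a::euclidean_space"
  assumes D: "convex D" and x0: "x0 \<in> interior X" "x0 \<in> D" and x1: "x1 \<in> rel_interior D"
  obtains t where "x0 - t *\<^sub>R (x0 - x1) \<in> interior X" "x0 - t *\<^sub>R (x0 - x1) \<in> rel_interior D"
proof -
  have "((\<lambda>t. x0 - t *\<^sub>R (x0 - x1)) \<longlongrightarrow> x0 - 0 *\<^sub>R (x0 - x1)) (at_right (0::real))"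
    by (intro tendsto_intros)
  then have "\<forall>\<^sub>F t in at_right 0. x0 - t *\<^sub>R (x0 - x1) \<in> interior X"
    using x0 by (intro topological_tendstoD) auto
  then have "\<forall>\<^sub>F t in at_right 0. x0 - t *\<^sub>R (x0 - x1) \<in> interior X \<and> t \<in> {0<..<1}"
    using eventually_at_right_real[of 0 "1::real"] by (auto intro: eventually_conj)
  then obtain t :: real where t: "x0 - t *\<^sub>R (x0 - x1) \<in> interior X" "t \<in> {0<..<1}"
    using eventually_happens' trivial_limit_at_right_real by (metis (no_types, lifting))
  then show thesis
    using rel_interior_convex_shrink[OF D x1 x0(2), of t] that by auto
qed

text \<open>Doubling the variable: \<open>G u\<close> is minimised over pairs \<open>(u, v)\<close>
  of \<open>D \<times> C\<close> with \<open>u - v = 0\<close>, and \<open>g\<close> is the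
  multiplier of that equation. Thus \<open>-g\<close> is a subgradient of \<open>G\<close> at
  \<open>x\<close> relative to \<open>D\<close>, and \<open>g\<close> is normal to \<open>C\<close>
  at \<open>x\<close>.\<close>

lemma convex_constrained_min_subgradient:
  fixes G :: "'a::euclidean_space \<Rightarrow> real"
  assumes C: "convex C" and D: "convex D" and G: "convex_on D G"
    and x: "x \<in> C \<inter> D" and min: "\<And>z. z \<in> C \<inter> D \<Longrightarrow> G x \<le> G z"
    and x0: "x0 \<in> C \<inter> interior D"
  shows "\<exists>g. (\<forall>z\<in>D. G x \<le> G z + g \<bullet> (z - x)) \<and> (\<forall>u\<in>C. g \<bullet> u \<le> g \<bullet> x)"
proof -
  have lin: "linear (\<lambda>p::'a \<times> 'a. fst p - snd p)"
    by (auto intro!: linearI simp: algebra_simps)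
  have GG: "convex_on (D \<times> C) (\<lambda>p. G (fst p))"
    using G C D by (force simp: convex_on_def convex_Times)
  obtain x1 where x1: "x1 \<in> rel_interior C"
    using C x rel_interior_eq_empty by blast
  obtain t where "x0 - t *\<^sub>R (x0 - x1) \<in> interior D" "x0 - t *\<^sub>R (x0 - x1) \<in> rel_interior C"
    using segment_meets_interior_rel_interior[OF C, of x0 D x1] x0 x1 by blast
  \<comment> \<open>This diagonal pair is the feasible point in the relative interior that the
    multiplier rule asks for.\<close>
  then have p: "(x0 - t *\<^sub>R (x0 - x1), x0 - t *\<^sub>R (x0 - x1)) \<in> rel_interior (D \<times> C)"
    using interior_subset_rel_interior by (fastforce simp: rel_interior_Times C D)
  then obtain g where g: "\<forall>p\<in>D \<times> C. G x \<le> G (fst p) + g \<bullet> (fst p - snd p - 0)"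
    using lagrange_multiplier_rel_interior[OF lin convex_Times[OF D C] GG, of "(x,x)" 0, OF _ _ _ p] x min
    by auto
  show ?thesis
  proof (intro exI[of _ g] conjI ballI)
    show "G x \<le> G z + g \<bullet> (z - x)" if "z \<in> D" for z
      using g x that by force
    show "g \<bullet> u \<le> g \<bullet> x" if "u \<in> C" for u
      using bspec[OF g, of "(x, u)"] x that by (auto simp: inner_diff_right)
  qed
qed

text \<open>\<open>x0\<close> may lie on the boundary of \<open>X\<close>, so separation is applied
  with the whole feasible set \<open>X \<inter> {z. L z = q}\<close> as \<open>C\<close>. It leaves
  a linear functional that is maximal at \<open>x\<close> over a polyhedron with equations, where
  \<open>lp_multiplier\<close> applies; the two inequalities add up.\<close>

lemma lagrange_multiplier_polyhedral:
  fixes L :: "'a::euclidean_space \<Rightarrow> 'b::euclidean_space" and G :: "'a \<Rightarrow> real"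
  assumes L: "linear L" and X: "polyhedron X" and D: "convex D" and G: "convex_on D G"
    and x: "x \<in> X \<inter> D" "L x = q" and min: "\<And>z. z \<in> X \<inter> D \<Longrightarrow> L z = q \<Longrightarrow> G x \<le> G z"
    and x0: "x0 \<in> X \<inter> interior D" "L x0 = q"
  shows "\<exists>y. \<forall>z\<in>X \<inter> D. G x \<le> G z + y \<bullet> (L z - q)"
proof -
  have "convex {z. L z = q}"
    using convex_linear_vimage[OF L, of "{q}"] by (simp add: vimage_def)
  then have "convex (X \<inter> {z. L z = q})"
    using X by (simp add: convex_Int polyhedron_imp_convex)
  then obtain g where g: "\<forall>z\<in>D. G x \<le> G z + g \<bullet> (z - x)" "\<forall>u\<in>X \<inter> {z. L z = q}. g \<bullet> u \<le> g \<bullet> x"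
    using convex_constrained_min_subgradient[OF _ D G, of "X \<inter> {z. L z = q}" x x0] x min x0 by blast
  then obtain y where y: "\<forall>z\<in>X. g \<bullet> z \<le> g \<bullet> x + y \<bullet> (L z - q)"
    using lp_multiplier[OF L X, of x q g] x by blast
  have "G x \<le> G z + y \<bullet> (L z - q)" if "z \<in> X \<inter> D" for z
    using g(1) y that by (fastforce simp: inner_diff_right)
  then show ?thesis by blast
qed

text \<open>The equation \<open>L z = q\<close> is preserved along the segment from
  \<open>x0\<close> to \<open>x1\<close>, so one of its points satisfies it and is in the relative
  interior of \<open>X \<inter> D\<close>.\<close>

lemma lagrange_multiplier_interior:
  fixes L :: "'a::euclidean_space \<Rightarrow> 'b::euclidean_space" and G :: "'a \<Rightarrow> real"
  assumes L: "linear L" and X: "convex X" and D: "convex D" and G: "convex_on D G"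
    and x: "x \<in> X \<inter> D" "L x = q" and min: "\<And>z. z \<in> X \<inter> D \<Longrightarrow> L z = q \<Longrightarrow> G x \<le> G z"
    and x0: "x0 \<in> interior X \<inter> D" "L x0 = q"
    and x1: "x1 \<in> rel_interior D" "L x1 = q"
  shows "\<exists>y. \<forall>z\<in>X \<inter> D. G x \<le> G z + y \<bullet> (L z - q)"
proof -
  obtain t where t: "x0 - t *\<^sub>R (x0 - x1) \<in> interior X" "x0 - t *\<^sub>R (x0 - x1) \<in> rel_interior D"
    using segment_meets_interior_rel_interior[OF D, of x0 X x1] x0 x1 by blast
  let ?x = "x0 - t *\<^sub>R (x0 - x1)"
  have "rel_interior X = interior X"
    using t(1) by (intro rel_interior_nonempty_interior) auto
  then have "?x \<in> rel_interior (X \<inter> D)"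
    using t by (subst convex_rel_interior_inter_two[OF X D]) auto
  moreover have "L ?x = q"
    using x0 x1 by (simp add: linear_diff[OF L] linear_cmul[OF L])
  moreover have "convex_on (X \<inter> D) G"
    using G X by (meson convex_Int convex_on_imp_convex convex_on_subset inf_le2)
  ultimately show ?thesis
    using lagrange_multiplier_rel_interior[OF L convex_Int[OF X D], of G x q ?x] x min by blast
qed

section \<open>Inexact proximal decomposition\<close>

text \<open>The inequality forces \<open>a (Suc n) \<le> a n + e n\<close>, so subtracting the
  accumulated errors from \<open>a\<close> leaves a decreasing sequence bounded below. Then
  \<open>b\<close> is squeezed between 0 and a difference of consecutive squares plus an error,
  which tends to 0.\<close>

lemma quasi_fejer:
  fixes a b e :: "nat \<Rightarrow> real"
  assumes a: "\<And>n. a n \<ge> 0" and b: "\<And>n. b n \<ge> 0" and e: "\<And>n. e n \<ge> 0" "summable e"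
    and step: "\<And>n. (a (Suc n))\<^sup>2 + b n \<le> (a n)\<^sup>2 + e n * a (Suc n)"
  shows "convergent a" and "b \<longlonglongrightarrow> 0"
proof -
  have le: "a (Suc n) \<le> a n + e n" for n
  proof (rule ccontr)
    assume "\<not> a (Suc n) \<le> a n + e n"
    then have gt: "a n + e n < a (Suc n)" by simp
    have "(a n)\<^sup>2 + e n * a (Suc n) \<le> a n * a (Suc n) + e n * a (Suc n)"
      using gt a[of n] e(1)[of n] by (simp add: power2_eq_square mult_left_mono)
    also have "\<dots> = (a n + e n) * a (Suc n)"
      by (simp add: algebra_simps)
    also have "\<dots> < (a (Suc n))\<^sup>2"
      using gt a[of n] e(1)[of n] by (simp add: power2_eq_square)
    finally show False
      using step[of n] b[of n] by simp
  qed
  define t where "t n = a n - sum e {..<n}" for n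
  have "decseq t"
    using le by (intro decseq_SucI) (simp add: t_def algebra_simps)
  moreover have "- suminf e \<le> t n" for n
    using a[of n] sum_le_suminf[OF e(2), of "{..<n}"] e(1) by (simp add: t_def)
  ultimately obtain t' where "t \<longlonglongrightarrow> t'"
    using decseq_convergent by blast
  then have "(\<lambda>n. t n + sum e {..<n}) \<longlonglongrightarrow> t' + suminf e"
    using summable_LIMSEQ[OF e(2)] by (intro tendsto_add)
  then have lim: "a \<longlonglongrightarrow> t' + suminf e" (is "_ \<longlonglongrightarrow> ?a")
    by (simp add: t_def)
  then show "convergent a"
    by (rule convergentI)
  have lim': "(\<lambda>n. a (Suc n)) \<longlonglongrightarrow> ?a"
    using lim by (rule LIMSEQ_Suc)
  have "(\<lambda>n. (a n)\<^sup>2 + e n * a (Suc n) - (a (Suc n))\<^sup>2) \<longlonglongrightarrow> ?a\<^sup>2 + 0 * ?a - ?a\<^sup>2"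
    by (intro tendsto_intros lim lim' summable_LIMSEQ_zero e)
  then show "b \<longlonglongrightarrow> 0"
    using b step by (intro tendsto_sandwich[of "\<lambda>_. 0" b _ "\<lambda>n. (a n)\<^sup>2 + e n * a (Suc n) - (a (Suc n))\<^sup>2"])
      (auto intro!: always_eventually simp: algebra_simps)
qed

lemma tendsto_zero_if_norm_square_le:
  fixes f :: "nat \<Rightarrow> 'a::real_normed_vector"
  assumes "\<And>n. (norm (f n))\<^sup>2 \<le> k * g n" and "g \<longlonglongrightarrow> 0"
  shows "f \<longlonglongrightarrow> 0"
proof (rule Lim_null_comparison)
  have "norm (f n) \<le> sqrt (k * g n)" for n
    using assms(1) by (rule real_le_rsqrt)
  then show "\<forall>\<^sub>F n in sequentially. norm (f n) \<le> sqrt (k * g n)"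
    by simp
  have "(\<lambda>n. sqrt (k * g n)) \<longlonglongrightarrow> sqrt (k * 0)"
    by (intro tendsto_intros assms)
  then show "(\<lambda>n. sqrt (k * g n)) \<longlonglongrightarrow> 0"
    by simp
qed

text \<open>Trades the smooth term \<open>h\<close> for its slope \<beta> at \<open>u\<close>:
  compare with the point at parameter \<open>t\<close> on the segment to \<open>z\<close>, use
  convexity of \<open>F\<close>, divide by \<open>t\<close> and let \<open>t\<close> tend to
  0.\<close>

lemma subgradient_remove_quadratic:
  fixes u s z :: "'a::real_inner"
  assumes D: "convex D" and F: "convex_on D F" and u: "u \<in> D" and z: "z \<in> D"
    and sub: "\<And>v. v \<in> D \<Longrightarrow> F u + h u + s \<bullet> (v - u) \<le> F v + h v"
    and h: "\<And>t::real. h (u + t *\<^sub>R (z - u)) = h u + t * \<beta> + t\<^sup>2 * \<gamma>"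
  shows "F u + s \<bullet> (z - u) - \<beta> \<le> F z"
proof -
  have le: "F u + s \<bullet> (z - u) - \<beta> \<le> F z + t * \<gamma>" if t: "t > 0" "t < 1" for t
  proof -
    have eq: "u + t *\<^sub>R (z - u) = (1 - t) *\<^sub>R u + t *\<^sub>R z"
      by (simp add: algebra_simps)
    have "u + t *\<^sub>R (z - u) \<in> D"
      unfolding eq using D u z t by (simp add: convexD)
    then have "F u + t * (s \<bullet> (z - u)) \<le> F (u + t *\<^sub>R (z - u)) + t * \<beta> + t\<^sup>2 * \<gamma>"
      using sub[of "u + t *\<^sub>R (z - u)"] h[of t] by simp
    also have "F (u + t *\<^sub>R (z - u)) \<le> (1 - t) * F u + t * F z"
      unfolding eq using F u z t by (simp add: convex_on_def)
    finally have "t * (F u + s \<bullet> (z - u) - \<beta>) \<le> t * (F z + t * \<gamma>)"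
      by (simp add: algebra_simps power2_eq_square)
    then show ?thesis
      using t mult_le_cancel_left_pos by blast
  qed
  have "((\<lambda>t. F z + t * \<gamma>) \<longlongrightarrow> F z + 0 * \<gamma>) (at_right 0)"
    by (intro tendsto_intros)
  moreover have "\<forall>\<^sub>F t in at_right 0. F u + s \<bullet> (z - u) - \<beta> \<le> F z + t * \<gamma>"
    using eventually_at_right_real[OF zero_less_one] by (rule eventually_mono) (use le in auto)
  ultimately show ?thesis
    using tendsto_lowerbound[OF _ _ trivial_limit_at_right_real] by fastforce
qed

text \<open>
  \<open>P\<close> is the projection onto \<open>W\<^sup>\<bottom>\<close>, the residual of the coupling constraint is \<open>L x - b0\<close>, \<open>F\<close> is the
  objective on its domain \<open>D\<close> (which incorporates \<open>X\<close>), and \<open>s n\<close> is a subgradient of the function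
  minimized in step \<open>n\<close>, at the point accepted.
\<close>

locale inexact_decomposition =
  fixes P :: "'b::euclidean_space \<Rightarrow> 'b" and L :: "'a::euclidean_space \<Rightarrow> 'b" and b0 :: 'b
    and D :: "'a set" and F :: "'a \<Rightarrow> real" and \<rho> c :: real
    and w y \<eta> :: "nat \<Rightarrow> 'b" and x s :: "nat \<Rightarrow> 'a"
  assumes P_linear: "linear P" and P_idem: "\<And>v. P (P v) = P v" and P_adj: "\<And>u v. P u \<bullet> v = u \<bullet> P v"
    and L_linear: "linear L"
    and D_convex: "convex D" and F_convex: "convex_on D F"
    and F_closed: "\<And>u z r r'. \<lbrakk>\<And>n. u n \<in> D; u \<longlonglongrightarrow> z; \<And>n. F (u n) \<le> r n; r \<longlonglongrightarrow> r'\<rbrakk> \<Longrightarrow> z \<in> D \<and> F z \<le> r'"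
    and \<rho>: "\<rho> > 0" and c: "c > 0"
    and w0: "P (w 0) = 0"
    and x_Suc: "x (Suc n) \<in> D"
    and \<eta>_Suc: "\<eta> (Suc n) = y n + (\<rho> / 2) *\<^sub>R (L (x (Suc n)) - b0 - w n)"
    and w_Suc: "w (Suc n) = w n + (1 / \<rho>) *\<^sub>R (\<eta> (Suc n) - P (\<eta> (Suc n)))"
    and y_Suc: "y (Suc n) = (1 / 2) *\<^sub>R (\<eta> (Suc n) + P (\<eta> (Suc n)))"
    and inexact: "v \<in> D \<Longrightarrow>
      F (x (Suc n)) + (\<rho> / 4 * (norm (L (x (Suc n)) - b0 - w n + (2 / \<rho>) *\<^sub>R y n))\<^sup>2
          + 1 / (2 * c) * (norm (x (Suc n) - x n))\<^sup>2) + s n \<bullet> (v - x (Suc n))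
      \<le> F v + (\<rho> / 4 * (norm (L v - b0 - w n + (2 / \<rho>) *\<^sub>R y n))\<^sup>2
          + 1 / (2 * c) * (norm (v - x n))\<^sup>2)"
    and s_summable: "summable (\<lambda>n. norm (s n))"
begin

text \<open>With \<open>P\<close> the projection onto the complement of \<open>W\<close>,
  \<open>wb\<close> lies in \<open>W\<close> and the multiplier \<open>yb\<close> in that
  complement; the last condition says that \<open>xb\<close> minimises
  \<open>F v + yb \<bullet> L v\<close> over \<open>D\<close>.\<close>

definition kkt :: "'b \<Rightarrow> 'a \<Rightarrow> 'b \<Rightarrow> bool" where
  "kkt wb xb yb \<longleftrightarrow> P wb = 0 \<and> P yb = yb \<and> L xb - b0 = wb \<and> xb \<in> D \<and>
     (\<forall>v\<in>D. F xb \<le> F v + yb \<bullet> (L v - L xb))"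

text \<open>
  Since \<open>y\<^sup>0\<close> is arbitrary, its component in \<open>W\<close> has to be tracked: it enters through \<open>d 0\<close>, while \<open>d n\<close>
  is the increment of \<open>w\<close> for \<open>n > 0\<close>.
\<close>

definition d :: "nat \<Rightarrow> 'b" where "d n = (2 / \<rho>) *\<^sub>R (y n - P (y n))"

definition V :: "'b \<Rightarrow> 'a \<Rightarrow> 'b \<Rightarrow> nat \<Rightarrow> real" where
  "V wb xb yb n = (1 / \<rho>) * (norm (P (y n) - yb))\<^sup>2 + \<rho> / 2 * (norm (w n - wb))\<^sup>2
     + \<rho> / 2 * (norm (d n))\<^sup>2 + 1 / (2 * c) * (norm (x n - xb))\<^sup>2"

text \<open>Squared increments weighted as the four terms of \<open>V\<close>; that of
  \<open>w\<close> is written with \<open>d (Suc n)\<close>, which equals it by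
  \<open>d_Suc\<close>.\<close>

definition decrease :: "nat \<Rightarrow> real" where
  "decrease n = (1 / \<rho>) * (norm (P (y (Suc n)) - P (y n)))\<^sup>2 + \<rho> / 2 * (norm (d (Suc n)))\<^sup>2
     + \<rho> / 2 * (norm (d (Suc n) - d n))\<^sup>2 + 1 / (2 * c) * (norm (x (Suc n) - x n))\<^sup>2"

section \<open>Components of the iterates in the range and the kernel of \<open>P\<close>\<close>

lemmas P_simps = linear_add[OF P_linear] linear_diff[OF P_linear] linear_cmul[OF P_linear] P_idem

lemma y_split: "y n = P (y n) + (\<rho> / 2) *\<^sub>R d n"
  using \<rho> by (simp add: d_def)

lemma P_d: "P (d n) = 0"
  by (simp add: d_def P_simps)

lemma P_y_Suc: "P (y (Suc n)) = P (\<eta> (Suc n))"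
proof -
  have "P (y (Suc n)) = (1/2) *\<^sub>R P (\<eta> (Suc n)) + (1/2) *\<^sub>R P (\<eta> (Suc n))"
    by (simp only: y_Suc P_simps scaleR_add_right)
  then show ?thesis
    by (simp flip: scaleR_add_left)
qed

lemma d_Suc: "d (Suc n) = w (Suc n) - w n"
proof -
  have "y (Suc n) - P (y (Suc n)) = (1 / 2) *\<^sub>R (\<eta> (Suc n) - P (\<eta> (Suc n)))"
    using scaleR_add_left[of "1/2" "1/2" "P (\<eta> (Suc n))"] unfolding P_y_Suc
    by (subst y_Suc, simp only: scaleR_add_right scaleR_diff_right) (simp add: algebra_simps)
  then show ?thesis
    by (simp add: d_def w_Suc)
qed

lemma \<eta>_split: "\<eta> (Suc n) = P (y (Suc n)) + \<rho> *\<^sub>R d (Suc n)"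
  using \<rho> by (simp add: d_Suc w_Suc P_y_Suc)

lemma P_w: "P (w n) = 0"
  by (induction n) (simp_all add: w0 w_Suc P_simps)

text \<open>The update of \<open>\<eta>\<close> solved for the residual, with
  \<open>\<eta>_split\<close> and \<open>y_split\<close> inserted. The residual thus differs from
  \<open>w n\<close> only by terms that will tend to 0.\<close>

lemma residual:
  "L (x (Suc n)) - b0 = w n + (2 / \<rho>) *\<^sub>R (P (y (Suc n)) - P (y n)) + 2 *\<^sub>R d (Suc n) - d n"
proof -
  have "(2 / \<rho>) *\<^sub>R (\<eta> (Suc n) - y n) = L (x (Suc n)) - b0 - w n"
    using \<rho> by (simp add: \<eta>_Suc)
  moreover have "(2 / \<rho>) *\<^sub>R (\<eta> (Suc n) - y n)
      = (2 / \<rho>) *\<^sub>R (P (y (Suc n)) - P (y n)) + 2 *\<^sub>R d (Suc n) - d n"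
    unfolding \<eta>_split by (subst y_split[of n]) (use \<rho> in \<open>simp add: algebra_simps\<close>)
  ultimately have "L (x (Suc n)) - b0 = w n + ((2 / \<rho>) *\<^sub>R (P (y (Suc n)) - P (y n)) + 2 *\<^sub>R d (Suc n) - d n)"
    by (metis add.commute diff_add_cancel)
  then show ?thesis
    by (simp add: add_diff_eq add.assoc)
qed

text \<open>The derivative of the penalty term in direction \<open>v - x (Suc n)\<close> is
  \<open>\<eta> (Suc n) \<bullet> (L v - L (x (Suc n)))\<close>, which explains the form of the
  multiplier update. The proximal term contributes the product with factor
  \<open>1 / c\<close>.\<close>

lemma subgradient_step:
  assumes "v \<in> D"
  shows "F (x (Suc n)) + s n \<bullet> (v - x (Suc n))
    - (\<eta> (Suc n) \<bullet> (L v - L (x (Suc n))) + (1 / c) * ((x (Suc n) - x n) \<bullet> (v - x (Suc n)))) \<le> F v"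
proof (rule subgradient_remove_quadratic[OF D_convex F_convex x_Suc assms inexact])
  fix t :: real
  let ?u = "x (Suc n)"
  let ?a = "L ?u - b0 - w n + (2 / \<rho>) *\<^sub>R y n"
  have sq: "(norm (p + t *\<^sub>R r))\<^sup>2 = (norm p)\<^sup>2 + t * (2 * (p \<bullet> r)) + t\<^sup>2 * (norm r)\<^sup>2" for p r :: "'c::real_inner"
    by (simp only: power2_norm_eq_inner)
      (simp add: inner_add_left inner_add_right inner_commute power2_eq_square algebra_simps)
  have \<eta>: "\<eta> (Suc n) = (\<rho> / 2) *\<^sub>R ?a"
    using \<rho> by (simp add: \<eta>_Suc algebra_simps)
  have 1: "L (?u + t *\<^sub>R (v - ?u)) - b0 - w n + (2 / \<rho>) *\<^sub>R y n = ?a + t *\<^sub>R (L v - L ?u)"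
    by (simp add: linear_add[OF L_linear] linear_diff[OF L_linear] linear_cmul[OF L_linear])
  have 2: "?u + t *\<^sub>R (v - ?u) - x n = (?u - x n) + t *\<^sub>R (v - ?u)"
    by simp
  show "\<rho> / 4 * (norm (L (?u + t *\<^sub>R (v - ?u)) - b0 - w n + (2 / \<rho>) *\<^sub>R y n))\<^sup>2
      + 1 / (2 * c) * (norm (?u + t *\<^sub>R (v - ?u) - x n))\<^sup>2
    = \<rho> / 4 * (norm ?a)\<^sup>2 + 1 / (2 * c) * (norm (?u - x n))\<^sup>2
      + t * (\<eta> (Suc n) \<bullet> (L v - L ?u) + (1 / c) * ((?u - x n) \<bullet> (v - ?u)))
      + t\<^sup>2 * (\<rho> / 4 * (norm (L v - L ?u))\<^sup>2 + 1 / (2 * c) * (norm (v - ?u))\<^sup>2)"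
    unfolding 1 2 sq \<eta> inner_scaleR_left using c by (simp add: field_simps)
qed

text \<open>The subgradient inequality at \<open>xb\<close> is added to the optimality of
  \<open>xb\<close> tested at \<open>x (Suc n)\<close>, which cancels \<open>F\<close>. What remains
  is a sum of products of an error and an increment, one for each term of \<open>V\<close>, and each
  becomes a difference of squares.\<close>

lemma V_step:
  assumes k: "kkt wb xb yb"
  shows "V wb xb yb (Suc n) + decrease n \<le> V wb xb yb n + s n \<bullet> (x (Suc n) - xb)"
proof -
  let ?z = "P (y n)" and ?z' = "P (y (Suc n))" and ?w = "w n" and ?w' = "w (Suc n)"
    and ?d = "d n" and ?d' = "d (Suc n)" and ?x = "x n" and ?x' = "x (Suc n)"
  have kk: "P wb = 0" "P yb = yb" "L xb - b0 = wb" "xb \<in> D" "F xb \<le> F ?x' + yb \<bullet> (L ?x' - L xb)"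
    using k x_Suc unfolding kkt_def by auto
  \<comment> \<open>Range and kernel of the self-adjoint projection \<open>P\<close> are
    orthogonal.\<close>
  have orth: "p \<bullet> r = 0" if "P p = p" "P r = 0" for p r
    using P_adj[of p r] that by simp
  have "L ?x' - L xb = (?w - wb) + (2 / \<rho>) *\<^sub>R (?z' - ?z) + 2 *\<^sub>R ?d' - ?d"
    using residual[of n] kk(3) by (simp add: algebra_simps)
  \<comment> \<open>\<open>w n + 2 d (Suc n) - d n\<close> is regrouped as
    \<open>w (Suc n) + (d (Suc n) - d n)\<close>, so that new errors appear instead of old
    ones.\<close>
  also have "\<dots> = (2 / \<rho>) *\<^sub>R (?z' - ?z) + ((?w' - wb) + (?d' - ?d))"
    by (simp add: d_Suc[of n] algebra_simps scaleR_2)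
  finally have Lx: "L ?x' - L xb = (2 / \<rho>) *\<^sub>R (?z' - ?z) + ((?w' - wb) + (?d' - ?d))" .
  have "(\<eta> (Suc n) - yb) \<bullet> (L ?x' - L xb)
      = ((?z' - yb) + \<rho> *\<^sub>R ?d') \<bullet> ((2 / \<rho>) *\<^sub>R (?z' - ?z) + ((?w' - wb) + (?d' - ?d)))"
    by (simp add: Lx \<eta>_split algebra_simps)
  also have "\<dots> = (?z' - yb) \<bullet> ((2 / \<rho>) *\<^sub>R (?z' - ?z)) + \<rho> *\<^sub>R ?d' \<bullet> ((?w' - wb) + (?d' - ?d))"
  proof -
    have "(?z' - yb) \<bullet> ((?w' - wb) + (?d' - ?d)) = 0"
      by (intro orth) (simp_all add: P_simps kk P_w P_d)
    moreover have "((2 / \<rho>) *\<^sub>R (?z' - ?z)) \<bullet> (\<rho> *\<^sub>R ?d') = 0"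
      by (intro orth) (simp_all add: P_simps P_d)
    then have "(\<rho> *\<^sub>R ?d') \<bullet> ((2 / \<rho>) *\<^sub>R (?z' - ?z)) = 0"
      by (simp only: inner_commute)
    ultimately show ?thesis
      by (simp only: inner_add_left inner_add_right[of _ "(2 / \<rho>) *\<^sub>R (?z' - ?z)"])
  qed
  also have "\<dots> = (2 / \<rho>) * ((?z' - yb) \<bullet> (?z' - ?z)) + \<rho> * ((?w' - wb) \<bullet> (?w' - ?w))
      + \<rho> * (?d' \<bullet> (?d' - ?d))"
    by (simp add: inner_add_right inner_commute d_Suc[of n] algebra_simps)
  finally have main: "(2 / \<rho>) * ((?z' - yb) \<bullet> (?z' - ?z)) + \<rho> * ((?w' - wb) \<bullet> (?w' - ?w))
      + \<rho> * (?d' \<bullet> (?d' - ?d)) + (1 / c) * ((?x' - xb) \<bullet> (?x' - ?x)) \<le> s n \<bullet> (?x' - xb)"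
    using subgradient_step[OF kk(4), of n] kk(5)
    by (simp add: inner_diff_left inner_diff_right inner_commute algebra_simps)
  \<comment> \<open>Three-point identity: the product of new error and increment is half of new
    error squared plus increment squared minus old error squared.\<close>
  have three: "(p - r) \<bullet> (p - p0) = ((norm (p - r))\<^sup>2 + (norm (p - p0))\<^sup>2 - (norm (p0 - r))\<^sup>2) / 2"
    for p r p0 :: "'c::real_inner"
    by (simp add: power2_norm_eq_inner inner_diff_left inner_diff_right inner_commute)
  have "(2 / \<rho>) * ((?z' - yb) \<bullet> (?z' - ?z))
      = (1 / \<rho>) * (norm (?z' - yb))\<^sup>2 + (1 / \<rho>) * (norm (?z' - ?z))\<^sup>2 - (1 / \<rho>) * (norm (?z - yb))\<^sup>2"
    unfolding three by (simp add: algebra_simps add_divide_distrib diff_divide_distrib)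
  moreover have "\<rho> * ((?w' - wb) \<bullet> (?w' - ?w))
      = \<rho> / 2 * (norm (?w' - wb))\<^sup>2 + \<rho> / 2 * (norm ?d')\<^sup>2 - \<rho> / 2 * (norm (?w - wb))\<^sup>2"
    unfolding three d_Suc[of n] by (simp add: algebra_simps add_divide_distrib diff_divide_distrib)
  moreover have "\<rho> * (?d' \<bullet> (?d' - ?d))
      = \<rho> / 2 * (norm ?d')\<^sup>2 + \<rho> / 2 * (norm (?d' - ?d))\<^sup>2 - \<rho> / 2 * (norm ?d)\<^sup>2"
  proof -
    have "?d' \<bullet> (?d' - ?d) = ((norm ?d')\<^sup>2 + (norm (?d' - ?d))\<^sup>2 - (norm ?d)\<^sup>2) / 2"
      using three[of ?d' 0 ?d] by simp
    then show ?thesis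
      by (simp only:) (simp add: algebra_simps add_divide_distrib diff_divide_distrib)
  qed
  moreover have "(1 / c) * ((?x' - xb) \<bullet> (?x' - ?x))
      = 1 / (2 * c) * (norm (?x' - xb))\<^sup>2 + 1 / (2 * c) * (norm (?x' - ?x))\<^sup>2 - 1 / (2 * c) * (norm (?x - xb))\<^sup>2"
    unfolding three by (simp add: algebra_simps add_divide_distrib diff_divide_distrib)
  ultimately show ?thesis
    using main unfolding V_def decrease_def by linarith
qed

lemma V_nonneg: "V wb xb yb n \<ge> 0" and decrease_nonneg: "decrease n \<ge> 0"
  unfolding V_def decrease_def using \<rho> c by simp_all

lemma V_dominates:
  "(norm (P (y n) - yb))\<^sup>2 \<le> \<rho> * V wb xb yb n"
  "(norm (w n - wb))\<^sup>2 \<le> 2 / \<rho> * V wb xb yb n"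
  "(norm (x n - xb))\<^sup>2 \<le> 2 * c * V wb xb yb n"
  unfolding V_def using \<rho> c by (simp_all add: algebra_simps)

text \<open>\<open>quasi_fejer\<close> is applied to the square root of \<open>V\<close>: by
  Cauchy-Schwarz and \<open>V_dominates\<close> the inexactness term is at most a summable factor
  times the new square root.\<close>

lemma kkt_limits:
  assumes "kkt wb xb yb"
  shows "convergent (V wb xb yb)" and "decrease \<longlonglongrightarrow> 0"
proof -
  let ?V = "V wb xb yb" and ?e = "\<lambda>n. sqrt (2 * c) * norm (s n)"
  have step: "(sqrt (?V (Suc n)))\<^sup>2 + decrease n \<le> (sqrt (?V n))\<^sup>2 + ?e n * sqrt (?V (Suc n))" for n
  proof -
    have "s n \<bullet> (x (Suc n) - xb) \<le> norm (s n) * norm (x (Suc n) - xb)"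
      by (rule norm_cauchy_schwarz)
    also have "\<dots> \<le> norm (s n) * sqrt (2 * c * ?V (Suc n))"
      by (intro mult_left_mono real_le_rsqrt V_dominates(3)) simp
    also have "\<dots> = ?e n * sqrt (?V (Suc n))"
      by (simp add: real_sqrt_mult)
    finally have "s n \<bullet> (x (Suc n) - xb) \<le> ?e n * sqrt (?V (Suc n))" .
    then show ?thesis
      using V_step[OF assms, of n] V_nonneg[of wb xb yb] by simp
  qed
  have e: "summable ?e"
    using s_summable by (rule summable_mult)
  have "convergent (\<lambda>n. sqrt (?V n))" and dec: "decrease \<longlonglongrightarrow> 0"
    using quasi_fejer[of "\<lambda>n. sqrt (?V n)" decrease ?e, OF _ _ _ e step] V_nonneg decrease_nonneg c
    by (simp_all)
  then obtain a where "(\<lambda>n. sqrt (?V n)) \<longlonglongrightarrow> a"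
    unfolding convergent_def by blast
  then have "(\<lambda>n. (sqrt (?V n))\<^sup>2) \<longlonglongrightarrow> a\<^sup>2"
    by (rule tendsto_power)
  then show "convergent ?V"
    using V_nonneg by (auto simp: convergent_def)
  show "decrease \<longlonglongrightarrow> 0" by (rule dec)
qed

lemma increments_vanish:
  assumes "decrease \<longlonglongrightarrow> 0"
  shows "(\<lambda>n. P (y (Suc n)) - P (y n)) \<longlonglongrightarrow> 0" "(\<lambda>n. d (Suc n)) \<longlonglongrightarrow> 0"
    "(\<lambda>n. d (Suc n) - d n) \<longlonglongrightarrow> 0" "(\<lambda>n. x (Suc n) - x n) \<longlonglongrightarrow> 0"
proof -
  note * = tendsto_zero_if_norm_square_le[OF _ assms]
  show "(\<lambda>n. P (y (Suc n)) - P (y n)) \<longlonglongrightarrow> 0"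
    by (rule *[where k = \<rho>]) (use \<rho> c in \<open>simp add: decrease_def algebra_simps\<close>)
  show "(\<lambda>n. d (Suc n)) \<longlonglongrightarrow> 0" "(\<lambda>n. d (Suc n) - d n) \<longlonglongrightarrow> 0"
    by (rule *[where k = "2 / \<rho>"]; use \<rho> c in \<open>simp add: decrease_def algebra_simps\<close>)+
  show "(\<lambda>n. x (Suc n) - x n) \<longlonglongrightarrow> 0"
    by (rule *[where k = "2 * c"]) (use \<rho> c in \<open>simp add: decrease_def algebra_simps\<close>)
qed

section \<open>Cluster points and convergence of the whole sequence\<close>

lemma cluster_point:
  assumes V: "convergent (V wb xb yb)"
  obtains r wc xc yc where "strict_mono r" "(\<lambda>n. w (r n)) \<longlonglongrightarrow> wc"
    "(\<lambda>n. x (r n)) \<longlonglongrightarrow> xc" "(\<lambda>n. P (y (r n))) \<longlonglongrightarrow> yc"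
proof -
  obtain M where M: "\<And>n. V wb xb yb n \<le> M"
    using convergent_imp_Bseq[OF V] by (auto simp: Bseq_def abs_le_iff)
  have bnd: "bounded (range f)" if "\<And>n. (norm (f n - b))\<^sup>2 \<le> k * V wb xb yb n" "k \<ge> 0"
    for f :: "nat \<Rightarrow> 'c::real_normed_vector" and b k
  proof (rule boundedI)
    fix v assume "v \<in> range f"
    then obtain n where v: "v = f n" by blast
    have "(norm (f n - b))\<^sup>2 \<le> k * M"
      using that(1)[of n] mult_left_mono[OF M that(2), of n] by linarith
    then have "norm (f n - b) \<le> sqrt (k * M)"
      by (rule real_le_rsqrt)
    then show "norm v \<le> sqrt (k * M) + norm b"
      unfolding v using norm_triangle_ineq[of "f n - b" b] by simp
  qed
  \<comment> \<open>One subsequence has to serve all three sequences, hence compactness is used for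
    the triple.\<close>
  have "bounded (range w \<times> range x \<times> range (\<lambda>n. P (y n)))"
    using bnd[OF V_dominates(1)] bnd[OF V_dominates(2)] bnd[OF V_dominates(3)] \<rho> c
    by (intro bounded_Times) simp_all
  then have "bounded (range (\<lambda>n. (w n, x n, P (y n))))"
    by (rule bounded_subset) auto
  then obtain l r where r: "strict_mono r" "((\<lambda>n. (w n, x n, P (y n))) \<circ> r) \<longlonglongrightarrow> l"
    using bounded_imp_convergent_subsequence by blast
  show thesis
    using that[OF r(1)] tendsto_fst[OF r(2)] tendsto_fst[OF tendsto_snd[OF r(2)]]
      tendsto_snd[OF tendsto_snd[OF r(2)]] by (simp add: o_def)
qed

text \<open>Passes to the limit in \<open>residual\<close> and in \<open>subgradient_step\<close>.
  Limits are taken at the shifted indices \<open>Suc (r n)\<close>, where \<open>d\<close> and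
  membership in \<open>D\<close> are controlled; vanishing increments make the shift harmless. The
  point \<open>v0\<close> lets \<open>key\<close> yield \<open>xc \<in> D\<close>.\<close>

lemma kkt_cluster_point:
  assumes dec: "decrease \<longlonglongrightarrow> 0" and D: "v0 \<in> D" and r: "strict_mono r"
    and lim: "(\<lambda>n. w (r n)) \<longlonglongrightarrow> wc" "(\<lambda>n. x (r n)) \<longlonglongrightarrow> xc" "(\<lambda>n. P (y (r n))) \<longlonglongrightarrow> yc"
  shows "kkt wc xc yc" and "(V wc xc yc \<circ> (\<lambda>n. Suc (r n))) \<longlonglongrightarrow> 0"
proof -
  note inc = increments_vanish[OF dec, THEN LIMSEQ_subseq_LIMSEQ[OF _ r], unfolded o_def]
  have P_cont: "(\<lambda>n. P (f n)) \<longlonglongrightarrow> P l" if "f \<longlonglongrightarrow> l" for f l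
    using P_linear that by (simp add: linear_conv_bounded_linear bounded_linear.tendsto)
  have L_cont: "(\<lambda>n. L (f n)) \<longlonglongrightarrow> L l" if "f \<longlonglongrightarrow> l" for f l
    using L_linear that by (simp add: linear_conv_bounded_linear bounded_linear.tendsto)
  have x': "(\<lambda>n. x (Suc (r n))) \<longlonglongrightarrow> xc"
    using tendsto_add[OF inc(4) lim(2)] by simp
  have y': "(\<lambda>n. P (y (Suc (r n)))) \<longlonglongrightarrow> yc"
    using tendsto_add[OF inc(1) lim(3)] by simp
  have w': "(\<lambda>n. w (Suc (r n))) \<longlonglongrightarrow> wc"
    using tendsto_add[OF inc(2) lim(1)] by (simp add: d_Suc)
  have "(\<lambda>n. P (y (Suc (r n))) + \<rho> *\<^sub>R d (Suc (r n))) \<longlonglongrightarrow> yc + \<rho> *\<^sub>R 0"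
    by (intro tendsto_intros y' inc)
  then have \<eta>: "(\<lambda>n. \<eta> (Suc (r n))) \<longlonglongrightarrow> yc"
    by (simp add: \<eta>_split)
  have Pw: "P wc = 0"
    using LIMSEQ_unique[OF P_cont[OF lim(1)]] by (simp add: P_w)
  have Py: "P yc = yc"
    using LIMSEQ_unique[OF P_cont[OF lim(3)]] lim(3) by (simp add: P_idem)
  have "(\<lambda>n. w (r n) + (2 / \<rho>) *\<^sub>R (P (y (Suc (r n))) - P (y (r n))) + d (Suc (r n)) + (d (Suc (r n)) - d (r n)))
      \<longlonglongrightarrow> wc + (2 / \<rho>) *\<^sub>R 0 + 0 + 0"
    by (intro tendsto_intros lim inc)
  then have "(\<lambda>n. L (x (Suc (r n))) - b0) \<longlonglongrightarrow> wc"
    by (simp add: residual scaleR_2 add_diff_eq add.assoc)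
  moreover have "(\<lambda>n. L (x (Suc (r n))) - b0) \<longlonglongrightarrow> L xc - b0"
    by (intro tendsto_intros L_cont x')
  ultimately have Lxc: "L xc - b0 = wc"
    using LIMSEQ_unique by blast
  have s0: "(\<lambda>n. s (r n)) \<longlonglongrightarrow> 0"
    using LIMSEQ_subseq_LIMSEQ[OF summable_LIMSEQ_zero[OF s_summable] r]
    by (simp add: o_def tendsto_norm_zero_iff)
  \<comment> \<open>\<open>F\<close> is only lower semicontinuous, so the subgradient inequality is
    read as a convergent upper bound on \<open>F (x (Suc (r n)))\<close> and handed to
    \<open>F_closed\<close>.\<close>
  have key: "xc \<in> D \<and> F xc \<le> F v + yc \<bullet> (L v - L xc)" if v: "v \<in> D" for v
  proof (rule F_closed[OF _ x'])
    show "x (Suc (r n)) \<in> D" for n by (rule x_Suc)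
    let ?r = "\<lambda>n. F v + \<eta> (Suc (r n)) \<bullet> (L v - L (x (Suc (r n))))
        + (1 / c) * ((x (Suc (r n)) - x (r n)) \<bullet> (v - x (Suc (r n)))) - s (r n) \<bullet> (v - x (Suc (r n)))"
    show "F (x (Suc (r n))) \<le> ?r n" for n
      using subgradient_step[OF v, of "r n"] by simp
    have "?r \<longlonglongrightarrow> F v + yc \<bullet> (L v - L xc) + (1 / c) * (0 \<bullet> (v - xc)) - 0 \<bullet> (v - xc)"
      by (intro tendsto_intros \<eta> L_cont x' s0 inc)
    then show "?r \<longlonglongrightarrow> F v + yc \<bullet> (L v - L xc)"
      by simp
  qed
  then show "kkt wc xc yc"
    unfolding kkt_def using Pw Py Lxc D by blast
  have "(\<lambda>n. V wc xc yc (Suc (r n))) \<longlonglongrightarrow> (1 / \<rho>) * (norm (yc - yc))\<^sup>2 + \<rho> / 2 * (norm (wc - wc))\<^sup>2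
     + \<rho> / 2 * (norm (0::'b))\<^sup>2 + 1 / (2 * c) * (norm (xc - xc))\<^sup>2"
    unfolding V_def by (intro tendsto_intros x' y' w' inc)
  then show "(V wc xc yc \<circ> (\<lambda>n. Suc (r n))) \<longlonglongrightarrow> 0"
    by (simp add: o_def)
qed

text \<open>\<open>V\<close> measured from the cluster point converges and tends to 0 along a
  subsequence, hence tends to 0. The limit of \<open>\<eta>\<close> equals that of its projection
  because \<open>d\<close> vanishes.\<close>

theorem converges_to_kkt_point:
  assumes "kkt w0 x0 y0"
  obtains wc xc yc where "kkt wc xc yc" "w \<longlonglongrightarrow> wc" "x \<longlonglongrightarrow> xc"
    "(\<lambda>n. \<eta> (Suc n)) \<longlonglongrightarrow> yc" "(\<lambda>n. P (\<eta> (Suc n))) \<longlonglongrightarrow> yc"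
proof -
  note lim0 = kkt_limits[OF assms]
  obtain r wc xc yc where r: "strict_mono r" "(\<lambda>n. w (r n)) \<longlonglongrightarrow> wc"
    "(\<lambda>n. x (r n)) \<longlonglongrightarrow> xc" "(\<lambda>n. P (y (r n))) \<longlonglongrightarrow> yc"
    using cluster_point[OF lim0(1)] .
  have "x0 \<in> D" using assms unfolding kkt_def by blast
  note cl = kkt_cluster_point[OF lim0(2) this r]
  obtain V0 where V0: "V wc xc yc \<longlonglongrightarrow> V0"
    using kkt_limits(1)[OF cl(1)] unfolding convergent_def by blast
  have "strict_mono (\<lambda>n. Suc (r n))"
    using r(1) by (simp add: strict_mono_def)
  then have "V0 = 0"
    using LIMSEQ_unique[OF LIMSEQ_subseq_LIMSEQ[OF V0] cl(2)] by simp
  with V0 have V0: "V wc xc yc \<longlonglongrightarrow> 0" by simp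
  note conv = LIM_zero_cancel[OF tendsto_zero_if_norm_square_le[OF _ V0]]
  have y: "(\<lambda>n. P (y n)) \<longlonglongrightarrow> yc"
    by (rule conv[OF V_dominates(1)])
  have "(\<lambda>n. P (y (Suc n)) + \<rho> *\<^sub>R d (Suc n)) \<longlonglongrightarrow> yc + \<rho> *\<^sub>R 0"
    by (intro tendsto_intros LIMSEQ_Suc[OF y] increments_vanish(2)[OF lim0(2)])
  then have "(\<lambda>n. \<eta> (Suc n)) \<longlonglongrightarrow> yc"
    by (simp add: \<eta>_split)
  moreover have "(\<lambda>n. P (\<eta> (Suc n))) \<longlonglongrightarrow> yc"
    using LIMSEQ_Suc[OF y] by (simp add: P_y_Suc)
  ultimately show thesis
    using that cl(1) conv[OF V_dominates(2)] conv[OF V_dominates(3)] by blast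
qed

end

section \<open>Separable programs\<close>

lemma part_add: "part blk k (x + z) = part blk k x + part blk k z"
  and part_diff: "part blk k (x - z) = part blk k x - part blk k z"
  and part_scaleR: "part blk k (c *\<^sub>R x) = c *\<^sub>R part blk k x"
  by (simp_all add: part_def vec_eq_iff)

lemma linear_part: "linear (part blk k)"
  by (intro linearI part_add part_scaleR)

lemma bounded_linear_part: "bounded_linear (part blk k :: real^'n::finite \<Rightarrow> _)"
  using linear_part[of blk k] by (simp only: linear_conv_bounded_linear)

lemma part_in_block_space [simp]: "part blk k x \<in> block_space blk k"
  by (simp add: part_def block_space_def)

lemma sum_part: "(\<Sum>k\<in>UNIV. part blk k x) = x" for blk :: "'n::finite \<Rightarrow> 'k::finite"
  by (simp add: vec_eq_iff part_def)

lemma inner_part: "s \<bullet> z = s \<bullet> part blk k z" if "s \<in> block_space blk k"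
  using that by (auto simp: inner_vec_def part_def block_space_def intro!: sum.cong)

lemma norm_square_sum_part:
  "(norm z)\<^sup>2 = (\<Sum>k\<in>UNIV. (norm (part blk k z))\<^sup>2)" for blk :: "'n::finite \<Rightarrow> 'k::finite"
proof -
  have "part blk k z \<bullet> z = part blk k z \<bullet> part blk k z" for k
    by (rule inner_part) simp
  then have "(\<Sum>k\<in>UNIV. part blk k z \<bullet> part blk k z) = (\<Sum>k\<in>UNIV. part blk k z) \<bullet> z"
    by (simp add: inner_sum_left)
  then show ?thesis
    by (simp add: sum_part power2_norm_eq_inner)
qed

lemma norm_square_vec: "(norm v)\<^sup>2 = (\<Sum>k\<in>UNIV. (norm (v $ k))\<^sup>2)" for v :: "'a::real_inner ^ 'k::finite"
  by (simp add: power2_norm_eq_inner inner_vec_def)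

lemma sum_matrix_part: "(\<Sum>k\<in>UNIV. E *v part blk k x) = E *v x"
  for blk :: "'n::finite \<Rightarrow> 'k::finite" and E :: "real^'n^'m::finite"
  by (simp add: sum_part flip: linear_sum[OF matrix_vector_mul_linear])

lemma sum_q_block: "(\<Sum>k\<in>UNIV. q_block l q k) = q" for l :: "'k::finite"
  by (simp add: q_block_def)

lemma sum_ereal_not_minf:
  fixes g :: "'k::finite \<Rightarrow> ereal"
  assumes "\<And>k. g k \<noteq> -\<infinity>"
  shows "(\<Sum>k\<in>UNIV. g k) = (if \<forall>k. g k \<noteq> \<infinity> then ereal (\<Sum>k\<in>UNIV. real_of_ereal (g k)) else \<infinity>)"
proof (cases "\<forall>k. g k \<noteq> \<infinity>")
  case True
  have "g k = ereal (real_of_ereal (g k))" for k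
    using assms[of k] True by (cases "g k") auto
  then have "(\<Sum>k\<in>UNIV. g k) = (\<Sum>k\<in>UNIV. ereal (real_of_ereal (g k)))"
    by (intro sum.cong) auto
  then show ?thesis
    using True by simp
next
  case False
  then show ?thesis
    by (auto simp: sum_Pinfty)
qed

text \<open>This is the orthogonal projection onto \<open>W_perp\<close> and the map behind the
  update of \<open>\<zeta>\<close>: the lemmas below show it to be linear, idempotent and
  self-adjoint, with kernel \<open>W_space\<close>.\<close>

definition mean_projection :: "real^'m^'k \<Rightarrow> real^'m^'k::finite" where
  "mean_projection v = (\<chi> k. (1 / real CARD('k)) *\<^sub>R (\<Sum>j\<in>UNIV. v $ j))"

lemma linear_mean_projection: "linear mean_projection"
  by (intro linearI) (simp_all add: mean_projection_def vec_eq_iff sum.distrib sum_distrib_left distrib_left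
      scaleR_sum_right ac_simps)

lemma mean_projection_eq_self: "mean_projection v = v" if "v \<in> W_perp" for v :: "real^'m::finite^'k::finite"
proof -
  have "(1 / real CARD('k)) *\<^sub>R (\<Sum>j\<in>UNIV. v $ j) = v $ k" for k
  proof -
    have "(\<Sum>j\<in>UNIV. v $ j) = (\<Sum>j\<in>(UNIV::'k set). v $ k)"
      using that unfolding W_perp_def by (intro sum.cong) auto
    then show ?thesis
      by (simp only: sum_constant_scaleR) simp
  qed
  then show ?thesis
    unfolding mean_projection_def vec_eq_iff[of _ v] vec_lambda_beta by (rule allI)
qed

lemma mean_projection_self_adjoint: "mean_projection u \<bullet> v = u \<bullet> mean_projection v"
  for u v :: "real^'m::finite^'k::finite"
proof -
  have "mean_projection u \<bullet> v = (1 / real CARD('k)) * ((\<Sum>j\<in>UNIV. u $ j) \<bullet> (\<Sum>j\<in>UNIV. v $ j))" for u v :: "real^'m^'k"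
    by (simp add: mean_projection_def inner_vec_def[of _ v] flip: sum_divide_distrib inner_sum_right)
  then show ?thesis
    by (metis inner_commute)
qed

lemma mean_projection_eq_0_iff: "mean_projection v = 0 \<longleftrightarrow> v \<in> W_space" for v :: "real^'m::finite^'k::finite"
  unfolding mean_projection_def vec_eq_iff[of _ "0 :: real^'m^'k"] W_space_def by simp

lemma mean_projection_in_W_perp: "mean_projection v \<in> W_perp"
  by (simp add: mean_projection_def W_perp_def)

lemma mean_projection_idem: "mean_projection (mean_projection v) = mean_projection v"
  for v :: "real^'m::finite^'k::finite"
  by (rule mean_projection_eq_self[OF mean_projection_in_W_perp])

locale separable_program =
  fixes blk :: "'n::finite \<Rightarrow> 'k::finite" and l :: 'k
    and f :: "'k \<Rightarrow> real^'n \<Rightarrow> ereal" and X :: "'k \<Rightarrow> (real^'n) set"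
    and E :: "real^'n^'m::finite" and q :: "real^'m"
  assumes f: "\<And>k. closed_proper_convex_on (block_space blk k) (f k)"
    and X: "\<And>k. X k \<subseteq> block_space blk k \<and> closed (X k) \<and> convex (X k)"
begin

definition dom_f :: "(real^'n) set" where
  "dom_f = {x. \<forall>k. f k (part blk k x) \<noteq> \<infinity>}"

text \<open>Meaningful on \<open>dom_f\<close> only, where it agrees with the objective; elsewhere
  \<open>real_of_ereal\<close> replaces infinite terms by 0.\<close>

definition F :: "real^'n \<Rightarrow> real" where
  "F x = (\<Sum>k\<in>UNIV. real_of_ereal (f k (part blk k x)))"

abbreviation "XX \<equiv> block_product blk X"

text \<open>Keeps the products of \<open>E\<close> with the blocks apart, so that
  \<open>L x - b0 = w\<close> expresses the block constraints of the decomposed problem.\<close>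

definition L :: "real^'n \<Rightarrow> real^'m^'k" where "L x = (\<chi> k. E *v part blk k x)"

definition b0 :: "real^'m^'k" where "b0 = (\<chi> k. q_block l q k)"

section \<open>Convexity and closedness of the separable objective\<close>

lemma f_not_minf: "f k (part blk k x) \<noteq> -\<infinity>"
  using f[of k] unfolding closed_proper_convex_on_def by auto

lemma f_dom: "x \<in> dom_f \<Longrightarrow> f k (part blk k x) = ereal (real_of_ereal (f k (part blk k x)))"
  using f_not_minf[of k x] by (cases "f k (part blk k x)") (auto simp: dom_f_def)

lemma sum_f:
  "(\<Sum>k\<in>UNIV. f k (part blk k x) + ereal (a k)) = (if x \<in> dom_f then ereal (F x + (\<Sum>k\<in>UNIV. a k)) else \<infinity>)"
proof -
  have "f k (part blk k x) + ereal (a k) \<noteq> -\<infinity>" for k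
    using f_not_minf[of k x] by (cases "f k (part blk k x)") auto
  moreover have "real_of_ereal (f k (part blk k x) + ereal (a k)) = real_of_ereal (f k (part blk k x)) + a k"
    if "x \<in> dom_f" for k
    by (subst f_dom[OF that]) simp
  moreover have "f k (part blk k x) + ereal (a k) \<noteq> \<infinity> \<longleftrightarrow> f k (part blk k x) \<noteq> \<infinity>" for k
    by simp
  ultimately show ?thesis
    by (subst sum_ereal_not_minf) (auto simp: dom_f_def F_def sum.distrib)
qed

lemma objective_eq: "objective blk f x = (if x \<in> dom_f then ereal (F x) else \<infinity>)"
  using sum_f[of x "\<lambda>_. 0"] by (simp add: objective_def zero_ereal_def[symmetric])

lemma effective_dom_objective: "effective_dom (objective blk f) = dom_f"
  by (auto simp: effective_dom_def objective_eq)

text \<open>Convexity of the epigraph, applied to the points of the graph above \<open>x\<close> and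
  \<open>z\<close>.\<close>

lemma f_convex:
  assumes "x \<in> dom_f" "z \<in> dom_f" "0 \<le> u" "0 \<le> v" "u + v = 1"
  shows "f k (part blk k (u *\<^sub>R x + v *\<^sub>R z))
    \<le> ereal (u * real_of_ereal (f k (part blk k x)) + v * real_of_ereal (f k (part blk k z)))"
proof -
  have "(part blk k y, real_of_ereal (f k (part blk k y))) \<in> epi_on (block_space blk k) (f k)" if "y \<in> dom_f" for y
    using f_dom[OF that, of k] by (simp add: epi_on_def)
  then have "u *\<^sub>R (part blk k x, real_of_ereal (f k (part blk k x))) + v *\<^sub>R (part blk k z, real_of_ereal (f k (part blk k z)))
      \<in> epi_on (block_space blk k) (f k)"
    using f[of k] assms unfolding closed_proper_convex_on_def by (intro convexD) auto
  then show ?thesis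
    by (simp add: epi_on_def part_add part_scaleR)
qed

lemma convex_dom_f: "convex dom_f"
proof (rule convexI)
  fix x z and u v :: real
  assume *: "x \<in> dom_f" "z \<in> dom_f" "0 \<le> u" "0 \<le> v" "u + v = 1"
  have "f k (part blk k (u *\<^sub>R x + v *\<^sub>R z)) \<noteq> \<infinity>" for k
    using f_convex[OF *, of k] by auto
  then show "u *\<^sub>R x + v *\<^sub>R z \<in> dom_f"
    by (simp add: dom_f_def)
qed

lemma convex_on_F: "convex_on dom_f F"
  unfolding convex_on_def
proof (intro conjI ballI allI impI convex_dom_f)
  fix x z and u v :: real
  assume *: "x \<in> dom_f" "z \<in> dom_f" "0 \<le> u" "0 \<le> v" "u + v = 1"
  then have "u *\<^sub>R x + v *\<^sub>R z \<in> dom_f"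
    using convex_dom_f by (simp add: convexD)
  then have "real_of_ereal (f k (part blk k (u *\<^sub>R x + v *\<^sub>R z)))
     \<le> u * real_of_ereal (f k (part blk k x)) + v * real_of_ereal (f k (part blk k z))" for k
    using f_convex[OF *, of k] f_dom[of _ k] by (metis ereal_less_eq(3))
  then show "F (u *\<^sub>R x + v *\<^sub>R z) \<le> u * F x + v * F z"
    unfolding F_def sum_distrib_left sum.distrib[symmetric] by (intro sum_mono)
qed

lemma convex_XX: "convex XX"
proof -
  have "XX = (\<Inter>k. part blk k -` X k)"
    by (auto simp: block_product_def)
  then show ?thesis
    using X by (auto intro!: convex_INT convex_linear_vimage linear_part)
qed

text \<open>The point at height \<open>\<alpha>\<close> above the limit lies off the epigraph, which
  is closed, so the points at the same height above \<open>u n\<close> are eventually off it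
  too.\<close>

lemma f_lower_semicontinuous:
  assumes \<alpha>: "ereal \<alpha> < f k (part blk k z)" and u: "u \<longlonglongrightarrow> z"
  shows "\<forall>\<^sub>F n in sequentially. ereal \<alpha> < f k (part blk k (u n))"
proof -
  let ?epi = "epi_on (block_space blk k) (f k)"
  have "closed ?epi"
    using f[of k] unfolding closed_proper_convex_on_def by blast
  then have "open (- ?epi)"
    by (rule open_Compl)
  moreover have "(part blk k z, \<alpha>) \<in> - ?epi"
    using \<alpha> by (simp add: epi_on_def)
  moreover have "(\<lambda>n. (part blk k (u n), \<alpha>)) \<longlonglongrightarrow> (part blk k z, \<alpha>)"
    using u by (intro tendsto_Pair tendsto_const bounded_linear.tendsto[OF bounded_linear_part])
  ultimately have "\<forall>\<^sub>F n in sequentially. (part blk k (u n), \<alpha>) \<in> - ?epi"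
    by (rule topological_tendstoD[rotated])
  then show ?thesis
    by (rule eventually_mono) (simp add: epi_on_def not_le)
qed

text \<open>
  The summands are bounded below separately, because a bound on the sum \<open>F (u n)\<close> alone does not
  prevent one block from tending to \<open>\<infinity>\<close> while another tends to \<open>-\<infinity>\<close>.
\<close>

lemma F_lower_bound:
  assumes \<alpha>: "\<And>k. ereal (\<alpha> k) < f k (part blk k z)"
    and u: "\<And>n. u n \<in> dom_f" "u \<longlonglongrightarrow> z" and r: "\<And>n. F (u n) \<le> r n" "r \<longlonglongrightarrow> r'"
  shows "(\<Sum>k\<in>UNIV. \<alpha> k) \<le> r'"
proof (rule tendsto_lowerbound[OF r(2)])
  have "\<forall>\<^sub>F n in sequentially. \<forall>k. ereal (\<alpha> k) < f k (part blk k (u n))"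
    by (intro eventually_all_finite f_lower_semicontinuous[OF \<alpha> u(2)])
  then show "\<forall>\<^sub>F n in sequentially. (\<Sum>k\<in>UNIV. \<alpha> k) \<le> r n"
  proof eventually_elim
    case (elim n)
    have "\<alpha> k \<le> real_of_ereal (f k (part blk k (u n)))" for k
      using elim f_dom[OF u(1), of k n] by (metis ereal_less_eq(3) less_imp_le)
    then have "(\<Sum>k\<in>UNIV. \<alpha> k) \<le> F (u n)"
      unfolding F_def by (intro sum_mono)
    then show ?case
      using r(1)[of n] by simp
  qed
qed simp

lemma F_closed:
  assumes u: "\<And>n. u n \<in> dom_f \<inter> XX" "u \<longlonglongrightarrow> z" and r: "\<And>n. F (u n) \<le> r n" "r \<longlonglongrightarrow> r'"
  shows "z \<in> dom_f \<inter> XX \<and> F z \<le> r'"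
proof -
  have "XX = (\<Inter>k. part blk k -` X k)"
    by (auto simp: block_product_def)
  then have "closed XX"
    using X by (auto intro!: closed_INT closed_vimage linear_continuous_on[OF bounded_linear_part])
  then have zX: "z \<in> XX"
    using u closed_sequentially by blast
  have ex: "\<exists>\<alpha>. ereal \<alpha> < f k (part blk k z)" for k
    using f_not_minf[of k z] by (cases "f k (part blk k z)") (auto intro: exI[of _ 0] lt_ex)
  then obtain \<alpha> where \<alpha>: "\<And>k. ereal (\<alpha> k) < f k (part blk k z)"
    by metis
  note bound = F_lower_bound[OF _ _ u(2) r]
  have zD: "z \<in> dom_f"
  proof (rule ccontr)
    assume "z \<notin> dom_f"
    then obtain j where j: "f j (part blk j z) = \<infinity>"
      by (auto simp: dom_f_def)
    \<comment> \<open>Block \<open>j\<close> has value \<infinity>, so any real lower bound is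
      allowed there; it is chosen to make the total \<open>r' + 1\<close>.\<close>
    let ?\<alpha> = "\<alpha>(j := r' + 1 - (\<Sum>k\<in>UNIV - {j}. \<alpha> k))"
    have "(\<Sum>k\<in>UNIV. ?\<alpha> k) \<le> r'"
      using u(1) \<alpha> j by (intro bound) auto
    moreover have "(\<Sum>k\<in>UNIV. ?\<alpha> k) = r' + 1"
      by (subst sum.remove[of _ j]) auto
    ultimately show False
      by simp
  qed
  moreover have "F z \<le> r'"
  proof (rule field_le_epsilon)
    fix e :: real assume e: "e > 0"
    \<comment> \<open>The bounds have to be strict, so the tolerance \<open>e\<close> is shared
      equally among the blocks.\<close>
    let ?\<alpha> = "\<lambda>k. real_of_ereal (f k (part blk k z)) - e / real CARD('k)"
    have "ereal (?\<alpha> k) < f k (part blk k z)" for k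
      by (subst f_dom[OF zD]) (use e in simp)
    then have "(\<Sum>k\<in>UNIV. ?\<alpha> k) \<le> r'"
      using u(1) by (intro bound) auto
    then show "F z \<le> r' + e"
      by (simp add: F_def sum_subtractf)
  qed
  ultimately show ?thesis
    using zX by blast
qed

lemma linear_L: "linear L"
  by (intro linearI) (simp_all add: L_def vec_eq_iff part_add part_scaleR matrix_vector_right_distrib
      matrix_vector_mult_scaleR)

text \<open>Bridge between the two formulations: \<open>L x - b0\<close> lies in
  \<open>W_space\<close> exactly when \<open>E *v x = q\<close>.\<close>

lemma sum_L: "(\<Sum>k\<in>UNIV. (L x - b0) $ k) = E *v x - q"
  by (simp add: L_def b0_def sum_subtractf sum_matrix_part sum_q_block)

lemma inner_L: "(\<And>k. \<eta> $ k = y) \<Longrightarrow> \<eta> \<bullet> L x = y \<bullet> (E *v x)"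
  by (simp add: inner_vec_def[of \<eta>] L_def sum_matrix_part flip: inner_sum_right)

section \<open>Existence of a multiplier\<close>

lemma solves_P_iff:
  "solves_P blk f X E q x \<longleftrightarrow> x \<in> XX \<and> E *v x = q \<and> (\<forall>z\<in>XX. E *v z = q \<longrightarrow> objective blk f x \<le> objective blk f z)"
  by (auto simp: solves_P_def is_arg_min_def not_less)

text \<open>Passes from the extended-real problem to the real function \<open>F\<close> on
  \<open>XX \<inter> dom_f\<close>, on which the multiplier rules operate, and treats the two
  alternatives of \<open>assumption_I\<close> separately.\<close>

lemma ex_multiplier:
  assumes I: "assumption_I blk f X E q" and dom: "domain_qualification blk f E q"
  shows "\<exists>x y. x \<in> dom_f \<inter> XX \<and> E *v x = q \<and> (\<forall>v\<in>dom_f \<inter> XX. F x \<le> F v + y \<bullet> (E *v v - q))"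
proof -
  note lin = matrix_vector_mul_linear[of E]
  obtain x where x: "x \<in> XX" "E *v x = q"
      and min: "\<And>z. z \<in> XX \<Longrightarrow> E *v z = q \<Longrightarrow> objective blk f x \<le> objective blk f z"
    using I unfolding assumption_I_def solves_P_iff by blast
  obtain x0 where x0: "x0 \<in> XX" "E *v x0 = q" "x0 \<in> dom_f"
    using I interior_subset unfolding assumption_I_def effective_dom_objective by blast
  \<comment> \<open>The feasible point \<open>x0\<close> has finite value, hence so does the
    minimiser.\<close>
  have xD: "x \<in> XX \<inter> dom_f"
    using min[OF x0(1,2)] x0(3) x(1) by (auto simp: objective_eq split: if_splits)
  have min': "F x \<le> F z" if "z \<in> XX \<inter> dom_f" "E *v z = q" for z
    using min[of z] that xD by (simp add: objective_eq)
  from I consider (int) x0 where "x0 \<in> interior XX \<inter> dom_f" "E *v x0 = q"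
    | (poly) x0 where "polyhedron XX" "x0 \<in> XX \<inter> interior dom_f" "E *v x0 = q"
    unfolding assumption_I_def effective_dom_objective by blast
  then have "\<exists>y. \<forall>v\<in>XX \<inter> dom_f. F x \<le> F v + y \<bullet> (E *v v - q)"
  proof cases
    case int
    obtain x1 where "x1 \<in> rel_interior dom_f" "E *v x1 = q"
      using dom unfolding domain_qualification_def effective_dom_objective by blast
    then show ?thesis
      using lagrange_multiplier_interior[OF lin convex_XX convex_dom_f convex_on_F xD x(2) min' int] by blast
  next
    case poly
    then show ?thesis
      using lagrange_multiplier_polyhedral[OF lin poly(1) convex_dom_f convex_on_F xD x(2) min'] by blast
  qed
  then show ?thesis
    using xD x(2) by blast
qed

lemma lagrangian_eq:
  assumes "w \<in> W_space" "x \<in> XX" "(\<eta>, \<zeta>) \<in> S_space"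
  shows "lagrangian blk l f X E q (w, x) (\<eta>, \<zeta>)
    = (if x \<in> dom_f then ereal (F x + \<eta> \<bullet> (L x - b0 - w)) else \<infinity>)"
proof -
  have "(\<Sum>j\<in>UNIV. f j (part blk j x) + ereal (\<eta> $ j \<bullet> (E *v part blk j x - q_block l q j)) - ereal (\<eta> $ j \<bullet> w $ j))
     = (\<Sum>j\<in>UNIV. f j (part blk j x) + ereal (\<eta> $ j \<bullet> (L x - b0 - w) $ j))"
  proof (rule sum.cong)
    fix j
    show "f j (part blk j x) + ereal (\<eta> $ j \<bullet> (E *v part blk j x - q_block l q j)) - ereal (\<eta> $ j \<bullet> w $ j)
      = f j (part blk j x) + ereal (\<eta> $ j \<bullet> (L x - b0 - w) $ j)"
      by (cases "f j (part blk j x)") (simp_all add: L_def b0_def inner_diff_right)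
  qed simp
  also have "\<dots> = (if x \<in> dom_f then ereal (F x + \<eta> \<bullet> (L x - b0 - w)) else \<infinity>)"
    by (simp add: sum_f inner_vec_def[of \<eta>])
  finally show ?thesis
    using assms by (simp add: lagrangian_def)
qed

section \<open>Consequences of the Karush-Kuhn-Tucker conditions\<close>

context
  fixes w :: "real^'m^'k" and x :: "real^'n" and y :: "real^'m"
  assumes w: "w \<in> W_space" "L x - b0 = w" and x: "x \<in> dom_f \<inter> XX"
    and min: "\<And>v. v \<in> dom_f \<inter> XX \<Longrightarrow> F x \<le> F v + y \<bullet> (E *v v - q)"
begin

lemma kkt_feasible: "E *v x = q"
  using w sum_L[of x] by (simp add: W_space_def)

lemma kkt_solves_P: "solves_P blk f X E q x"
proof -
  have "objective blk f x \<le> objective blk f z" if "z \<in> XX" "E *v z = q" for z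
    using that x min[of z] by (simp add: objective_eq)
  then show ?thesis
    using x kkt_feasible by (simp add: solves_P_iff)
qed

text \<open>The second component of every feasible pair is feasible for (P), and the objective
  ignores the first, so minimality carries over.\<close>

lemma kkt_solves_Pw: "solves_Pw blk l f X E q (w, x)"
proof -
  have "w' \<in> W_space \<and> x' \<in> XX \<and> L x' - b0 = w'" if "(w', x') \<in> feasible_Pw blk l X E q" for w' x'
    using that by (auto simp: feasible_Pw_def W_space_def block_product_def L_def b0_def q_block_def vec_eq_iff[of _ w'])
  then have "x' \<in> XX \<and> E *v x' = q" if "(w', x') \<in> feasible_Pw blk l X E q" for w' x'
    using that sum_L[of x'] by (fastforce simp: W_space_def)
  moreover have "(w, x) \<in> feasible_Pw blk l X E q"
    using w x by (auto simp: feasible_Pw_def W_space_def block_product_def L_def b0_def q_block_def)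
  ultimately show ?thesis
    using kkt_solves_P unfolding solves_P_iff solves_Pw_def is_arg_min_def
    by (auto simp: not_less)
qed

text \<open>Weak duality bounds every dual value by the objective at the feasible point
  \<open>x\<close>; \<open>min\<close> says that the dual value at \<open>y\<close> reaches
  it.\<close>

lemma kkt_solves_D: "solves_D blk f X E q y"
proof -
  have "dual_objective blk f X E q y' \<le> objective blk f x" for y'
    unfolding dual_objective_def
    by (rule INF_lower2[of x]) (use x kkt_feasible in \<open>simp_all flip: zero_ereal_def\<close>)
  moreover have "objective blk f x \<le> dual_objective blk f X E q y"
    unfolding dual_objective_def
  proof (rule INF_greatest)
    fix v assume "v \<in> XX"
    then show "objective blk f x \<le> objective blk f v + ereal (y \<bullet> (E *v v - q))"
      using x min[of v] by (simp add: objective_eq)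
  qed
  ultimately show ?thesis
    unfolding solves_D_def is_arg_max_def by (metis (no_types) leD order_trans)
qed

text \<open>Against a vector with equal components every \<open>w'\<close> of \<open>W_space\<close>
  drops out, which leaves the Lagrangian of (P) with multiplier \<open>y\<close>. In the other
  variable the Lagrangian at \<open>(w, x)\<close> is constant on \<open>S_space\<close>, as
  \<open>L x - b0 = w\<close>.\<close>

lemma kkt_saddle_point:
  assumes \<eta>: "\<And>k. \<eta> $ k = y"
  shows "saddle_point blk l f X E q (w, x) (\<eta>, \<eta>)"
proof -
  have "\<eta> \<in> W_perp"
    using \<eta> by (simp add: W_perp_def)
  then have S: "(\<eta>, \<eta>) \<in> S_space"
    by (simp add: S_space_def closest_point_self)
  have "\<eta> \<bullet> (L v - b0 - w') = y \<bullet> (E *v v - q)" if "w' \<in> W_space" for w' v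
  proof -
    have "\<eta> \<bullet> u = y \<bullet> (\<Sum>k\<in>UNIV. u $ k)" for u
      by (simp add: inner_vec_def[of \<eta>] \<eta> inner_sum_right)
    then show ?thesis
      using that sum_L[of v] by (simp add: W_space_def sum_subtractf)
  qed
  then have L1: "lagrangian blk l f X E q (w', v) (\<eta>, \<eta>) = (if v \<in> dom_f then ereal (F v + y \<bullet> (E *v v - q)) else \<infinity>)"
    if "w' \<in> W_space" "v \<in> XX" for w' v
    using that S by (simp add: lagrangian_eq)
  have "is_arg_min (\<lambda>p'. lagrangian blk l f X E q p' (\<eta>, \<eta>)) (\<lambda>p'. p' \<in> W_space \<times> XX) (w, x)"
    using x w(1) min kkt_feasible by (auto simp: is_arg_min_def L1 not_less split: if_splits)
  moreover have "is_arg_max (lagrangian blk l f X E q (w, x)) (\<lambda>d'. d' \<in> S_space) (\<eta>, \<eta>)"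
    using x w S by (auto simp: is_arg_max_def lagrangian_eq)
  ultimately show ?thesis
    unfolding saddle_point_def by simp
qed

end

section \<open>The algorithm as an inexact proximal decomposition\<close>

lemma block_stationarity:
  assumes s: "s \<in> subdifferential_on (block_space blk k)
      (restrict_to (X k) (phi blk l f E q \<rho> c w x y k)) (part blk k x')"
    and x': "x' \<in> XX" and v: "v \<in> dom_f \<inter> XX"
  defines "h \<equiv> \<lambda>z. \<rho> / 4 * (norm ((L z - b0 - w + (2 / \<rho>) *\<^sub>R y) $ k))\<^sup>2
                    + 1 / (2 * c) * (norm (part blk k (z - x)))\<^sup>2"
  shows "f k (part blk k x') \<noteq> \<infinity>"
    and "real_of_ereal (f k (part blk k x')) + h x' + s \<bullet> (v - x') \<le> real_of_ereal (f k (part blk k v)) + h v"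
proof -
  have phi: "restrict_to (X k) (phi blk l f E q \<rho> c w x y k) (part blk k z) = f k (part blk k z) + ereal (h z)"
    if "z \<in> XX" for z
    using that by (simp add: restrict_to_def block_product_def phi_def h_def L_def b0_def part_diff)
  have "s \<in> block_space blk k" and sub: "f k (part blk k x') + ereal (h x') + ereal (s \<bullet> (part blk k v - part blk k x'))
     \<le> f k (part blk k v) + ereal (h v)"
    using s v x' unfolding subdifferential_on_def by (auto simp flip: phi)
  moreover have fv: "f k (part blk k v) = ereal (real_of_ereal (f k (part blk k v)))"
    using v by (intro f_dom) blast
  \<comment> \<open>As \<open>s\<close> lies in \<open>block_space blk k\<close>, it does not see
    the other blocks, so the full vectors may be used.\<close>
  ultimately have *: "f k (part blk k x') + ereal (h x') + ereal (s \<bullet> (v - x'))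
     \<le> ereal (real_of_ereal (f k (part blk k v)) + h v)"
    using inner_part[of s blk k "v - x'"] by (metis part_diff plus_ereal.simps(1))
  \<comment> \<open>The right side is finite, as \<open>v\<close> has finite objective; this
    excludes \<infinity> on the left.\<close>
  then show "f k (part blk k x') \<noteq> \<infinity>"
    by auto
  then show "real_of_ereal (f k (part blk k x')) + h x' + s \<bullet> (v - x') \<le> real_of_ereal (f k (part blk k v)) + h v"
    using * f_not_minf[of k x'] by (cases "f k (part blk k x')") auto
qed

text \<open>The block inequalities are added: squared norms split over the blocks, and comparison
  with \<open>v\<close> puts \<open>x'\<close> in the domain.\<close>

lemma stationarity:
  assumes s: "\<And>k. s k \<in> subdifferential_on (block_space blk k)
      (restrict_to (X k) (phi blk l f E q \<rho> c w x y k)) (part blk k x')"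
    and x': "x' \<in> XX" and v: "v \<in> dom_f \<inter> XX"
  shows "x' \<in> dom_f"
    and "F x' + (\<rho> / 4 * (norm (L x' - b0 - w + (2 / \<rho>) *\<^sub>R y))\<^sup>2 + 1 / (2 * c) * (norm (x' - x))\<^sup>2)
        + (\<Sum>k\<in>UNIV. s k) \<bullet> (v - x')
      \<le> F v + (\<rho> / 4 * (norm (L v - b0 - w + (2 / \<rho>) *\<^sub>R y))\<^sup>2 + 1 / (2 * c) * (norm (v - x))\<^sup>2)"
proof -
  note block = block_stationarity[OF s x' v]
  show "x' \<in> dom_f"
    using block(1) by (simp add: dom_f_def)
  have quad: "(\<Sum>k\<in>UNIV. a * (norm (u $ k))\<^sup>2) = a * (norm u)\<^sup>2"
    "(\<Sum>k\<in>UNIV. a * (norm (part blk k z))\<^sup>2) = a * (norm z)\<^sup>2" for a and u :: "real^'m^'k" and z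
    by (simp_all only: norm_square_vec[of u] norm_square_sum_part[where z = z and blk = blk] sum_distrib_left)
  have "(\<Sum>k\<in>UNIV. real_of_ereal (f k (part blk k x')) + (\<rho> / 4 * (norm ((L x' - b0 - w + (2 / \<rho>) *\<^sub>R y) $ k))\<^sup>2
                    + 1 / (2 * c) * (norm (part blk k (x' - x)))\<^sup>2) + s k \<bullet> (v - x'))
     \<le> (\<Sum>k\<in>UNIV. real_of_ereal (f k (part blk k v)) + (\<rho> / 4 * (norm ((L v - b0 - w + (2 / \<rho>) *\<^sub>R y) $ k))\<^sup>2
                    + 1 / (2 * c) * (norm (part blk k (v - x)))\<^sup>2))"
    by (intro sum_mono block(2))
  then show "F x' + (\<rho> / 4 * (norm (L x' - b0 - w + (2 / \<rho>) *\<^sub>R y))\<^sup>2 + 1 / (2 * c) * (norm (x' - x))\<^sup>2)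
        + (\<Sum>k\<in>UNIV. s k) \<bullet> (v - x')
      \<le> F v + (\<rho> / 4 * (norm (L v - b0 - w + (2 / \<rho>) *\<^sub>R y))\<^sup>2 + 1 / (2 * c) * (norm (v - x))\<^sup>2)"
    unfolding F_def sum.distrib quad inner_sum_left by simp
qed

text \<open>
  The summable slack \<open>(1/2)\<^sup>n\<close> makes it unnecessary to show that the distance is attained.
\<close>

lemma ex_small_subgradients:
  assumes stop: "stopping_criterion blk l f X E q \<rho> c \<epsilon> w x y" and \<epsilon>: "summable \<epsilon>" and \<rho>: "\<rho> > 0" and c: "c > 0"
  obtains s where "\<And>n k. s n k \<in> subdifferential_on (block_space blk k)
      (restrict_to (X k) (phi blk l f E q \<rho> c (w n) (x n) (y n) k)) (part blk k (x (Suc n)))"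
    and "summable (\<lambda>n. norm (\<Sum>k\<in>UNIV. s n k))"
proof -
  define C where "C = c * real CARD('k) * (\<rho> * onorm ((*v) E) + onorm ((*v) E) + 1)"
  define \<delta> where "\<delta> n = \<epsilon> n / C + (1/2) ^ n" for n
  define S where "S n k = subdifferential_on (block_space blk k)
      (restrict_to (X k) (phi blk l f E q \<rho> c (w n) (x n) (y n) k)) (part blk k (x (Suc n)))" for n k
  have "\<exists>s\<in>S n k. norm s < \<delta> n" for n k
  proof -
    have "dist_zero (S n k) \<le> ereal (\<epsilon> n / C)"
      using stop unfolding stopping_criterion_def C_def S_def by blast
    also have "\<dots> < ereal (\<delta> n)"
      by (simp add: \<delta>_def)
    finally show ?thesis
      by (simp add: dist_zero_def INF_less_iff)
  qed
  then obtain s where s: "\<And>n k. s n k \<in> S n k" "\<And>n k. norm (s n k) < \<delta> n"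
    by metis
  have "summable \<delta>"
    unfolding \<delta>_def by (intro summable_add summable_divide \<epsilon> summable_geometric) simp
  then have sm: "summable (\<lambda>n. real CARD('k) * \<delta> n)"
    by (rule summable_mult)
  have le: "norm (\<Sum>k\<in>UNIV. s n k) \<le> real CARD('k) * \<delta> n" for n
    using sum_norm_le[of UNIV "s n" "\<lambda>_. \<delta> n"] s(2) by (simp add: less_imp_le)
  have "summable (\<lambda>n. norm (\<Sum>k\<in>UNIV. s n k))"
    by (rule summable_comparison_test'[OF sm, where N = 0]) (simp only: real_norm_def abs_norm_cancel le)
  then show thesis
    using that s(1) unfolding S_def by blast
qed

text \<open>The update rules are read as equations between whole vectors, with
  \<open>mean_projection\<close> as \<open>P\<close>. The point \<open>v0\<close> of finite
  objective is what \<open>stationarity\<close> uses to place \<open>x (Suc n)\<close> in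
  \<open>dom_f\<close>.\<close>

lemma algorithm_inexact_decomposition:
  assumes run: "algorithm_run blk l X E q \<rho> w x y \<eta> \<zeta>" and \<rho>: "\<rho> > 0" and c: "c > 0"
    and s: "\<And>n k. s n k \<in> subdifferential_on (block_space blk k)
      (restrict_to (X k) (phi blk l f E q \<rho> c (w n) (x n) (y n) k)) (part blk k (x (Suc n)))"
      "summable (\<lambda>n. norm (\<Sum>k\<in>UNIV. s n k))"
    and v0: "v0 \<in> dom_f \<inter> XX"
  shows "inexact_decomposition mean_projection L b0 (dom_f \<inter> XX) F \<rho> c w y \<eta> x (\<lambda>n. \<Sum>k\<in>UNIV. s n k)"
    and "\<zeta> (Suc n) = mean_projection (\<eta> (Suc n))"
proof -
  have it: "x (Suc n) \<in> XX"
    "\<eta> (Suc n) = y n + (\<rho> / 2) *\<^sub>R (L (x (Suc n)) - b0 - w n)"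
    "\<zeta> (Suc n) = mean_projection (\<eta> (Suc n))"
    "w (Suc n) = w n + (1 / \<rho>) *\<^sub>R (\<eta> (Suc n) - \<zeta> (Suc n))"
    "y (Suc n) = (1 / 2) *\<^sub>R (\<eta> (Suc n) + \<zeta> (Suc n))" for n
  proof -
    have comp: "part blk k (x (Suc n)) \<in> X k"
      "\<eta> (Suc n) $ k = y n $ k + (\<rho> / 2) *\<^sub>R (E *v part blk k (x (Suc n)) - q_block l q k - w n $ k)"
      "\<zeta> (Suc n) $ k = (1 / real CARD('k)) *\<^sub>R (\<Sum>j\<in>UNIV. \<eta> (Suc n) $ j)"
      "w (Suc n) $ k = w n $ k + (1 / \<rho>) *\<^sub>R (\<eta> (Suc n) $ k - \<zeta> (Suc n) $ k)"
      "y (Suc n) $ k = (1 / 2) *\<^sub>R (\<eta> (Suc n) $ k + \<zeta> (Suc n) $ k)" for k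
      using run unfolding algorithm_run_def by blast+
    show "x (Suc n) \<in> XX"
      by (simp add: block_product_def comp(1))
    show "\<eta> (Suc n) = y n + (\<rho> / 2) *\<^sub>R (L (x (Suc n)) - b0 - w n)"
      unfolding vec_eq_iff[of "\<eta> (Suc n)"] by (simp add: comp(2) L_def b0_def)
    show "\<zeta> (Suc n) = mean_projection (\<eta> (Suc n))"
      unfolding vec_eq_iff[of "\<zeta> (Suc n)"] by (simp only: comp(3) mean_projection_def vec_lambda_beta) simp
    show "w (Suc n) = w n + (1 / \<rho>) *\<^sub>R (\<eta> (Suc n) - \<zeta> (Suc n))"
      unfolding vec_eq_iff[of "w (Suc n)"] by (simp add: comp(4))
    show "y (Suc n) = (1 / 2) *\<^sub>R (\<eta> (Suc n) + \<zeta> (Suc n))"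
      unfolding vec_eq_iff[of "y (Suc n)"] by (simp add: comp(5) scaleR_add_right)
  qed
  show "\<zeta> (Suc n) = mean_projection (\<eta> (Suc n))"
    by (rule it)
  show "inexact_decomposition mean_projection L b0 (dom_f \<inter> XX) F \<rho> c w y \<eta> x (\<lambda>n. \<Sum>k\<in>UNIV. s n k)"
  proof (rule inexact_decomposition.intro, goal_cases)
    case 5 show ?case by (rule convex_Int[OF convex_dom_f convex_XX])
  next
    case 6 show ?case
      using convex_on_subset[OF convex_on_F, of "dom_f \<inter> XX"] convex_Int[OF convex_dom_f convex_XX] by simp
  next
    case (7 u z r r')
    then show ?case by (rule F_closed)
  next
    case 10 show ?case
      using run by (simp add: algorithm_run_def mean_projection_eq_0_iff)
  next
    case (11 n) show ?case
      using stationarity(1)[OF s(1) it(1) v0] it(1) by blast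
  next
    case (12 n) show ?case by (rule it)
  next
    case (13 n) show ?case using it(3,4) by simp
  next
    case (14 n) show ?case using it(3,5) by simp
  next
    case (15 v n) show ?case
      by (rule stationarity(2)[OF s(1) it(1) 15])
  qed (simp_all add: linear_mean_projection mean_projection_idem mean_projection_self_adjoint linear_L \<rho> c s(2))
qed

end

theorem theorem5p1:
  fixes blk :: "'n::finite \<Rightarrow> 'k::finite" and l :: 'k
    and f :: "'k \<Rightarrow> real^'n \<Rightarrow> ereal" and X :: "'k \<Rightarrow> (real^'n) set"
    and E :: "real^'n^'m::finite" and q :: "real^'m"
    and \<rho> c :: real and \<epsilon> :: "nat \<Rightarrow> real"
    and w y \<eta> \<zeta> :: "nat \<Rightarrow> real^'m^'k" and x :: "nat \<Rightarrow> real^'n"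
  assumes f: "\<And>k. closed_proper_convex_on (block_space blk k) (f k)"
    and X: "\<And>k. X k \<subseteq> block_space blk k \<and> closed (X k) \<and> convex (X k)"
    and I: "assumption_I blk f X E q"
    and dom_f: "domain_qualification blk f E q"
    and \<rho>: "\<rho> > 0" and c: "c > 0"
    and run: "algorithm_run blk l X E q \<rho> w x y \<eta> \<zeta>"
    and stop: "stopping_criterion blk l f X E q \<rho> c \<epsilon> w x y"
    and \<epsilon>: "summable \<epsilon>"
  shows "\<exists>w' x' \<eta>' \<zeta>'.
           (\<lambda>\<nu>. (w \<nu>, x \<nu>, \<eta> \<nu>, \<zeta> \<nu>)) \<longlonglongrightarrow> (w', x', \<eta>', \<zeta>') \<and>
           saddle_point blk l f X E q (w', x') (\<eta>', \<zeta>') \<and>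
           solves_Pw blk l f X E q (w', x') \<and>
           solves_P blk f X E q x' \<and>
           (\<exists>y'. (\<forall>k. \<eta>' $ k = y') \<and> solves_D blk f X E q y')"
proof -
  interpret separable_program blk l f X E q
    using f X by unfold_locales auto
  obtain s where s: "\<And>n k. s n k \<in> subdifferential_on (block_space blk k)
      (restrict_to (X k) (phi blk l f E q \<rho> c (w n) (x n) (y n) k)) (part blk k (x (Suc n)))"
    "summable (\<lambda>n. norm (\<Sum>k\<in>UNIV. s n k))"
    by (rule ex_small_subgradients[OF stop \<epsilon> \<rho> c]) (rule that)
  obtain x0 y0 where x0: "x0 \<in> dom_f \<inter> XX" "E *v x0 = q" "\<forall>v\<in>dom_f \<inter> XX. F x0 \<le> F v + y0 \<bullet> (E *v v - q)"
    using ex_multiplier[OF I assms(4)] by blast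
  note alg = algorithm_inexact_decomposition[OF run \<rho> c s x0(1)]
  interpret A: inexact_decomposition mean_projection L b0 "dom_f \<inter> XX" F \<rho> c w y \<eta> x "\<lambda>n. \<Sum>k\<in>UNIV. s n k"
    by (rule alg(1))
  \<comment> \<open>\<open>const\<close> embeds a multiplier of the single constraint
    \<open>E *v x = q\<close> into \<open>W_perp\<close>.\<close>
  define const :: "real^'m \<Rightarrow> real^'m^'k" where "const y = (\<chi> k. y)" for y
  have inner_const: "const y \<bullet> (L v - L v') = y \<bullet> (E *v v - E *v v')" for y v v'
    using inner_L[of "const y" y] by (simp add: const_def inner_diff_right)
  have "A.kkt (L x0 - b0) x0 (const y0)"
    unfolding A.kkt_def
  proof (intro conjI ballI)
    show "mean_projection (L x0 - b0) = 0"
      using sum_L[of x0] x0(2) by (simp add: mean_projection_eq_0_iff W_space_def)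
    show "mean_projection (const y0) = const y0"
      by (rule mean_projection_eq_self) (simp add: const_def W_perp_def)
  qed (use x0 in \<open>auto simp: inner_const\<close>)
  then obtain w' x' \<eta>' where lim: "A.kkt w' x' \<eta>'" "w \<longlonglongrightarrow> w'" "x \<longlonglongrightarrow> x'"
    "(\<lambda>n. \<eta> (Suc n)) \<longlonglongrightarrow> \<eta>'" "(\<lambda>n. mean_projection (\<eta> (Suc n))) \<longlonglongrightarrow> \<eta>'"
    using A.converges_to_kkt_point by blast
  \<comment> \<open>The limits are known for indices \<open>Suc n\<close>; the arbitrary entries at
    index 0 do not affect them.\<close>
  have "\<eta> \<longlonglongrightarrow> \<eta>'" "\<zeta> \<longlonglongrightarrow> \<eta>'"
    using lim(4,5) by (auto simp flip: alg(2) intro: LIMSEQ_imp_Suc)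
  then have conv: "(\<lambda>\<nu>. (w \<nu>, x \<nu>, \<eta> \<nu>, \<zeta> \<nu>)) \<longlonglongrightarrow> (w', x', \<eta>', \<eta>')"
    using lim(2,3) by (intro tendsto_Pair)
  \<comment> \<open>The limit multiplier is fixed by averaging, hence its components agree.\<close>
  have "\<eta>' \<in> W_perp"
    using lim(1) mean_projection_in_W_perp[of \<eta>'] unfolding A.kkt_def by simp
  then obtain y' where y': "\<And>k. \<eta>' $ k = y'"
    unfolding W_perp_def by blast
  have w': "w' \<in> W_space" "L x' - b0 = w'" and x': "x' \<in> dom_f \<inter> XX"
    using lim(1) by (simp_all add: A.kkt_def mean_projection_eq_0_iff)
  have "E *v x' = q"
    using w' sum_L[of x'] by (simp add: W_space_def)
  then have min: "F x' \<le> F v + y' \<bullet> (E *v v - q)" if "v \<in> dom_f \<inter> XX" for v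
    using lim(1) that inner_L[of \<eta>' y', OF y'] by (simp add: A.kkt_def inner_diff_right)
  note kkt = w' x' min
  show ?thesis
    using conv kkt_saddle_point[OF kkt y'] kkt_solves_Pw[OF kkt] kkt_solves_P[OF kkt] kkt_solves_D[OF kkt] y'
    by blast
qed

end
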